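(* Let $n\ge 1$ and $k\ge 0$ be integers. For any partition $\alpha\in\mathcal P(n,k)$, $f_\alpha(p)$ is an integral polynomial in $p$ with coefficients independent of $p$; i.e., there exists a polynomial $g_\alpha(T)\in\mathbb{Z}[T]$ such that $f_\alpha(p)=g_\alpha(p)$ for every prime $p$.
   Context: An $n$-dimensional lattice is the $\mathbb{Z}$-span of $n$ linearly independent vectors in a Euclidean space; a sublattice is a subset which is itself an $n$-dimensional lattice. The invariant factors of a sublattice $\Lambda^*$ of $\Lambda$ are the diagonal entries $d_1\mid\cdots\mid d_n$ (positive integers) of the Smith normal form of the integer matrix expressing a basis of $\Lambda^*$ in a basis of $\Lambda$; they do not depend on the choices of bases. $\mathcal P(n,k)=\{(\alpha_1,\dots,\alpha_n)\in\mathbb{Z}^n: 0\le\alpha_1\le\cdots\le\alpha_n,\ \sum_{i=1}^n\alpha_i=k\}$. For a prime $p$ and $\alpha\in\mathcal P(n,k)$, $f_\alpha(p)$ is the number of sublattices of an $n$-dimensional lattice $\Lambda$ with invariant factors $p^{\alpha_1},\dots,p^{\alpha_n}$ (this does not depend on $\Lambda$). Equivalently it is the cardinality of the corresponding class under the equivalence: $\Lambda^*\sim\Lambda^\bullet$ if there is a linear transformation $\sigma$ with $\sigma(\Lambda)=\Lambda$ and $\sigma(\Lambda^* )=\Lambda^\bullet$. *)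

theory Defs
  imports
    "HOL-Computational_Algebra.Primes"
    "HOL-Computational_Algebra.Polynomial"
    "Jordan_Normal_Form.VS_Connect"
begin

(* Lattices live in the Euclidean space R^m, represented by carrier_vec m.  A basis is
   given by the columns of a real m x n matrix, so m may exceed the rank n. *)

definition lattice_basis :: "nat \<Rightarrow> nat \<Rightarrow> real mat \<Rightarrow> real vec set \<Rightarrow> bool" where
  "lattice_basis m n B L \<longleftrightarrow>
     B \<in> carrier_mat m n \<and>
     distinct (cols B) \<and>
     \<not> module.lin_dep class_ring (module_vec TYPE(real) m) (set (cols B)) \<and>
     L = {B *\<^sub>v map_vec real_of_int c | c. c \<in> carrier_vec n}"

definition is_lattice :: "nat \<Rightarrow> nat \<Rightarrow> real vec set \<Rightarrow> bool" where
  "is_lattice m n L \<longleftrightarrow> (\<exists>B. lattice_basis m n B L)"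

definition sublattice :: "nat \<Rightarrow> nat \<Rightarrow> real vec set \<Rightarrow> real vec set \<Rightarrow> bool" where
  "sublattice m n L' L \<longleftrightarrow> is_lattice m n L' \<and> L' \<subseteq> L"

definition smith_normal_form :: "nat \<Rightarrow> int mat \<Rightarrow> int mat \<Rightarrow> bool" where
  "smith_normal_form n A D \<longleftrightarrow>
     D \<in> carrier_mat n n \<and> diagonal_mat D \<and>
     (\<forall>i<n. 0 \<le> D $$ (i, i)) \<and>
     (\<forall>i. Suc i < n \<longrightarrow> D $$ (i, i) dvd D $$ (Suc i, Suc i)) \<and>
     (\<exists>P Q. P \<in> carrier_mat n n \<and> Q \<in> carrier_mat n n \<and>
            invertible_mat P \<and> invertible_mat Q \<and> D = P * A * Q)"

(* The matrix A expresses the basis B' of L' in the basis B of L.  It is nonsingular, so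
   the invariant factors ds are automatically positive. *)

definition invariant_factors ::
  "nat \<Rightarrow> nat \<Rightarrow> real vec set \<Rightarrow> real vec set \<Rightarrow> int list \<Rightarrow> bool" where
  "invariant_factors m n L L' ds \<longleftrightarrow>
     (\<exists>B B' A D. lattice_basis m n B L \<and> lattice_basis m n B' L' \<and>
        A \<in> carrier_mat n n \<and> B' = B * map_mat real_of_int A \<and>
        smith_normal_form n A D \<and> ds = diag_mat D)"

definition ordered_partitions :: "nat \<Rightarrow> nat \<Rightarrow> nat list set" where
  "ordered_partitions n k = {\<alpha>. length \<alpha> = n \<and> sorted \<alpha> \<and> sum_list \<alpha> = k}"

definition sublattices_of_type ::
  "nat \<Rightarrow> nat \<Rightarrow> real vec set \<Rightarrow> nat list \<Rightarrow> nat \<Rightarrow> real vec set set" where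
  "sublattices_of_type m n L \<alpha> p =
     {L'. sublattice m n L' L \<and> invariant_factors m n L L' (map (\<lambda>a. int p ^ a) \<alpha>)}"

end

theory Submission
  imports Defs "HOL-Library.Function_Algebras" "Jordan_Normal_Form.DL_Rank"
begin

text \<open>
Fix a basis \<open>B\<close> of \<open>\<Lambda>\<close>.  The sublattices of \<open>\<Lambda>\<close> are the sets \<open>B H\<close> for subgroups \<open>H\<close> of finite
index in \<open>\<int>\<^sup>n\<close>, and \<open>B H\<close> has invariant factors \<open>p ^ \<alpha>\<^sub>1, \<dots>, p ^ \<alpha>\<^sub>n\<close> exactly if some additive
automorphism of \<open>\<int>\<^sup>n\<close> carries the diagonal lattice \<open>p ^ \<alpha>\<^sub>1 \<int> \<oplus> \<dots> \<oplus> p ^ \<alpha>\<^sub>n \<int>\<close> to \<open>H\<close>.  So the task is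
to count such \<open>H\<close>.

The first idea is to replace the automorphism by numbers (\<open>has_type\<close>): \<open>H\<close> has type \<open>\<alpha>\<close> if it
contains some \<open>p ^ N \<int>\<^sup>n\<close> and if for every \<open>j\<close> its image in \<open>(\<int> / p ^ j)\<^sup>n\<close> has
\<open>p ^ (\<Sum> max(j - \<alpha>\<^sub>i, 0))\<close> elements.  These cardinalities are visibly invariant under automorphisms,
and they are multiplicative when one vector is adjoined to a lattice in a coordinate hyperplane
(\<open>card_reduce_adjoin\<close>), so that a summand can be cancelled from a type by cancelling a factor in
an equation between natural numbers.

The second idea is to split off the smallest exponent \<open>a\<close> of \<open>\<alpha> = a # \<alpha>'\<close>.  All entries of \<open>H\<close> are
divisible by \<open>p ^ a\<close>, and if coordinate \<open>i\<close> of some vector of \<open>H\<close> is not divisible by \<open>p ^ (a + 1)\<close>,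
then \<open>H = \<int> v + M\<close> where \<open>v\<^sub>i = p ^ a\<close> and \<open>M = {x \<in> H. x\<^sub>i = 0}\<close> has type \<open>\<alpha>'\<close>
(\<open>has_type_split_off\<close>).  Conversely every such \<open>M\<close> and \<open>v\<close> give a lattice of type \<open>\<alpha>\<close>, and \<open>v\<close>
matters only modulo \<open>M\<close>.  For the resulting recursion to close up, one counts the lattices of
type \<open>\<alpha>\<close> all of whose entries are divisible by \<open>p ^ a\<close>, and by \<open>p ^ (a + 1)\<close> on a given set \<open>J\<close> of
\<open>s\<close> coordinates.  With \<open>n\<close> the length of \<open>a # \<alpha>'\<close> and \<open>F\<^sub>a(\<alpha>, s)\<close> the count, distinguishing
whether a coordinate \<open>i \<notin> J\<close> may be added to \<open>J\<close> gives
\<open>F\<^sub>a(a # \<alpha>', s) = F\<^sub>a(a # \<alpha>', s + 1) + p ^ (\<Sum>\<alpha>' - a (n - 1) - s) * F\<^sub>a(\<alpha>', s)\<close>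
(\<open>card_typed_in_frame_rec\<close>) with \<open>F\<^sub>a(a # \<alpha>', n) = 0\<close>.  The power of \<open>p\<close> is the number of choices of
\<open>v\<close> modulo \<open>M\<close>.  If the head \<open>b\<close> of \<open>\<alpha>\<close> exceeds \<open>a\<close>, then the divisibility conditions hold
automatically and \<open>F\<^sub>a(\<alpha>, s) = F\<^sub>b(\<alpha>, 0)\<close>.  The prime enters this recursion only through powers with
exponents independent of it, so the solution is a polynomial in \<open>p\<close> with integer coefficients
(\<open>card_typed_in_frame_polynomial\<close>).

The same splitting, applied repeatedly, shows that a lattice of type \<open>\<alpha>\<close> is an automorphic image
of the diagonal lattice (\<open>has_type_adapted_coordinates\<close>), which closes the circle between the
numerical definition and the Smith normal form (\<open>sublattices_of_type_eq\<close>).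
\<close>

section \<open>Subgroups of a coordinate space over the integers\<close>

text \<open>
The free abelian group on a set \<open>I\<close> of coordinates.  Deleting a coordinate then means passing to
\<open>intvecs (I - {i})\<close>, with no renumbering.
\<close>

definition intvecs :: "nat set \<Rightarrow> (nat \<Rightarrow> int) set" where
  "intvecs I = {x. \<forall>i. i \<notin> I \<longrightarrow> x i = 0}"

definition submodule_of :: "nat set \<Rightarrow> (nat \<Rightarrow> int) set \<Rightarrow> bool" where
  "submodule_of I H \<longleftrightarrow> H \<subseteq> intvecs I \<and> 0 \<in> H \<and> (\<forall>x\<in>H. \<forall>y\<in>H. x - y \<in> H)"

definition scale :: "int \<Rightarrow> (nat \<Rightarrow> int) \<Rightarrow> nat \<Rightarrow> int" where
  "scale t x = (\<lambda>i. t * x i)"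

lemma scale_apply: "scale t x i = t * x i"
  by (simp add: scale_def)

text \<open>
Vectors are mostly treated as elements of a group.  The simplifier would evaluate sums and
differences of vectors into functions of the coordinate, so these rules are invoked only where an
identity is verified coordinate by coordinate.
\<close>

lemmas pointwise = scale_apply plus_fun_apply zero_fun_apply minus_apply uminus_apply

declare pointwise [simp del]

lemma scale_zero [simp]: "scale 0 x = 0"
  by (auto simp: pointwise)

lemma scale_one [simp]: "scale 1 x = x"
  by (auto simp: pointwise)

definition reduce :: "int \<Rightarrow> (nat \<Rightarrow> int) \<Rightarrow> nat \<Rightarrow> int" where
  "reduce q x = (\<lambda>i. x i mod q)"

text \<open>
For sorted \<open>\<alpha>\<close> this says that the invariant factors of \<open>H\<close> are the powers \<open>p ^ a\<close> with \<open>a\<close> in \<open>\<alpha>\<close>.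
The diagonal lattice with these factors has the stated cardinalities, and the numbers
\<open>\<Sum> max(j - a, 0)\<close> for all \<open>j\<close> determine the multiset of exponents of a given length; the
truncated subtraction of natural numbers is essential.  The second conjunct excludes
lattices whose index has a prime factor other than \<open>p\<close>, which reduction modulo \<open>p ^ j\<close> cannot see.
\<close>

definition has_type :: "nat \<Rightarrow> nat set \<Rightarrow> nat list \<Rightarrow> (nat \<Rightarrow> int) set \<Rightarrow> bool" where
  "has_type p I \<alpha> H \<longleftrightarrow> submodule_of I H \<and>
     (\<exists>N. \<forall>x\<in>intvecs I. scale (int p ^ N) x \<in> H) \<and>
     (\<forall>j. card (reduce (int p ^ j) ` H) = p ^ (\<Sum>a\<leftarrow>\<alpha>. j - a))"

definition adjoin :: "(nat \<Rightarrow> int) set \<Rightarrow> (nat \<Rightarrow> int) \<Rightarrow> (nat \<Rightarrow> int) set" where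
  "adjoin M v = {x. \<exists>t. x - scale t v \<in> M}"

definition diag_lattice :: "nat set \<Rightarrow> (nat \<Rightarrow> int) \<Rightarrow> (nat \<Rightarrow> int) set" where
  "diag_lattice I d = {x \<in> intvecs I. \<forall>i\<in>I. d i dvd x i}"

lemma submodule_of_diff: "submodule_of I H \<Longrightarrow> x \<in> H \<Longrightarrow> y \<in> H \<Longrightarrow> x - y \<in> H"
  by (auto simp: submodule_of_def)

lemma submodule_of_zero: "submodule_of I H \<Longrightarrow> 0 \<in> H"
  by (auto simp: submodule_of_def)

lemma submodule_of_intvecs: "submodule_of I H \<Longrightarrow> x \<in> H \<Longrightarrow> x \<in> intvecs I"
  by (auto simp: submodule_of_def)

lemma submodule_of_uminus:
  assumes "submodule_of I H" "x \<in> H" shows "- x \<in> H"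
  using submodule_of_diff[OF assms(1) submodule_of_zero[OF assms(1)] assms(2)] by simp

lemma submodule_of_add:
  assumes "submodule_of I H" "x \<in> H" "y \<in> H" shows "x + y \<in> H"
  using submodule_of_diff[OF assms(1,2) submodule_of_uminus[OF assms(1,3)]] by simp

lemma submodule_of_scale:
  assumes "submodule_of I H" "x \<in> H" shows "scale t x \<in> H"
proof -
  have nat: "scale (int n) x \<in> H" for n
  proof (induction n)
    case 0
    show ?case using submodule_of_zero[OF assms(1)] by (simp only: of_nat_0 scale_zero)
  next
    case (Suc n)
    have "scale (int (Suc n)) x = scale (int n) x + x"
      by (auto simp: pointwise algebra_simps)
    then show ?case using submodule_of_add[OF assms(1) Suc assms(2)] by simp
  qed
  show ?thesis
  proof (cases "t \<ge> 0")
    case True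
    then show ?thesis using nat[of "nat t"] by simp
  next
    case False
    have "scale t x = - scale (int (nat (- t))) x" using False by (auto simp: pointwise)
    then show ?thesis using submodule_of_uminus[OF assms(1) nat[of "nat (-t)"]] by simp
  qed
qed

section \<open>Images modulo powers of a prime\<close>

lemma reduce_eq_iff: "reduce q x = reduce q y \<longleftrightarrow> (\<forall>i. q dvd x i - y i)"
  by (simp add: pointwise reduce_def fun_eq_iff mod_eq_dvd_iff)

lemma card_image_same_kernel:
  assumes "\<And>x y. x \<in> C \<Longrightarrow> y \<in> C \<Longrightarrow> f x = f y \<longleftrightarrow> g x = g y"
  shows "card (f ` C) = card (g ` C)"
proof -
  have "bij_betw (\<lambda>y. g (inv_into C f y)) (f ` C) (g ` C)"
    unfolding bij_betw_def
  proof
    show "inj_on (\<lambda>y. g (inv_into C f y)) (f ` C)"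
      by (rule inj_onI) (metis assms f_inv_into_f inv_into_into)
    show "(\<lambda>y. g (inv_into C f y)) ` f ` C = g ` C"
      unfolding image_image
      by (rule image_cong[OF refl]) (metis assms f_inv_into_f inv_into_into imageI)
  qed
  then show ?thesis by (rule bij_betw_same_card)
qed

lemma card_multiples_mod:
  assumes "p > 0"
  shows "card (range (\<lambda>t. t * int p ^ a mod int p ^ j)) = p ^ (j - a)"
proof (cases "j \<le> a")
  case True
  then have "int p ^ j dvd int p ^ a" by (simp add: le_imp_power_dvd)
  then have "range (\<lambda>t. t * int p ^ a mod int p ^ j) = {0}" by auto
  then show ?thesis using True by simp
next
  case False
  then have j: "int p ^ j = int p ^ (j - a) * int p ^ a"
    by (simp flip: power_add)
  have "range (\<lambda>t. t * int p ^ a mod int p ^ j) = (\<lambda>t. t * int p ^ a) ` range (\<lambda>t. t mod int p ^ (j - a))"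
    by (simp add: j image_image mod_mult_mult2)
  also have "range (\<lambda>t. t mod int p ^ (j - a)) = {0..<int p ^ (j - a)}"
  proof
    show "range (\<lambda>t. t mod int p ^ (j - a)) \<subseteq> {0..<int p ^ (j - a)}"
      using assms by auto
    show "{0..<int p ^ (j - a)} \<subseteq> range (\<lambda>t. t mod int p ^ (j - a))"
      by (auto intro!: image_eqI[of x _ x for x])
  qed
  also have "card ((\<lambda>t. t * int p ^ a) ` {0..<int p ^ (j - a)}) = p ^ (j - a)"
    using assms by (subst card_image) (auto intro: inj_onI simp flip: of_nat_power)
  finally show ?thesis .
qed

text \<open>
Since \<open>v\<close> is \<open>p ^ a\<close> times a vector with \<open>i\<close>-th entry \<open>1\<close>, the coordinate \<open>i\<close> of \<open>t v + m\<close> modulo \<open>p ^ j\<close>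
determines \<open>t v\<close> modulo \<open>p ^ j\<close>.  Hence the image of the adjoined lattice is in bijection with the
product of the image of \<open>p ^ a \<int>\<close> and the image of \<open>M\<close>.
\<close>

lemma card_reduce_adjoin:
  assumes p: "p > 0" and M: "submodule_of I M" "\<And>x. x \<in> M \<Longrightarrow> x i = 0"
    and v: "v i = int p ^ a" "\<And>k. int p ^ a dvd v k"
  shows "card (reduce (int p ^ j) ` adjoin M v) = p ^ (j - a) * card (reduce (int p ^ j) ` M)"
proof -
  let ?q = "int p ^ j"
  \<comment> \<open>For \<open>x = t v + m\<close> the second component is the image of \<open>m\<close>, because \<open>t = x i div p ^ a\<close>.\<close>
  define g where "g x = (x i mod ?q, reduce ?q (x - scale (x i div int p ^ a) v))" for x
  have coord: "x i = t * int p ^ a" "x i div int p ^ a = t" if "x - scale t v \<in> M" for x t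
    using M(2)[OF that] v p by (auto simp: pointwise)
  have "card (reduce ?q ` adjoin M v) = card (g ` adjoin M v)"
  proof (rule card_image_same_kernel)
    fix x y assume "x \<in> adjoin M v" "y \<in> adjoin M v"
    then obtain t s where ts: "x - scale t v \<in> M" "y - scale s v \<in> M" by (auto simp: adjoin_def)
    note c = coord[OF ts(1)] coord[OF ts(2)]
    have g: "g x = (t * int p ^ a mod ?q, reduce ?q (x - scale t v))"
      "g y = (s * int p ^ a mod ?q, reduce ?q (y - scale s v))"
      unfolding g_def c(2,4) unfolding c(1,3) by simp_all
    have key: "?q dvd (t * v k - s * v k)" if "?q dvd t * int p ^ a - s * int p ^ a" for k
    proof -
      obtain r where "v k = int p ^ a * r" using v(2)[of k] by (auto simp: dvd_def)
      then have "t * v k - s * v k = (t * int p ^ a - s * int p ^ a) * r" by (simp add: algebra_simps)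
      then show ?thesis using that by simp
    qed
    have diff: "(x k - t * v k) - (y k - s * v k) = (x k - y k) - (t * v k - s * v k)" for k
      by simp
    show "reduce ?q x = reduce ?q y \<longleftrightarrow> g x = g y"
    proof
      assume L: "reduce ?q x = reduce ?q y"
      then have 1: "?q dvd x k - y k" for k by (simp add: reduce_eq_iff)
      from 1[of i] have 2: "?q dvd t * int p ^ a - s * int p ^ a" by (simp add: c)
      have "?q dvd (x k - t * v k) - (y k - s * v k)" for k
        unfolding diff using 1[of k] key[OF 2] by (rule dvd_diff)
      then show "g x = g y" using 2 by (simp add: g reduce_eq_iff mod_eq_dvd_iff pointwise)
    next
      assume R: "g x = g y"
      then have 2: "?q dvd t * int p ^ a - s * int p ^ a"
        and 3: "?q dvd (x k - t * v k) - (y k - s * v k)" for k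
        by (auto simp: g reduce_eq_iff mod_eq_dvd_iff pointwise)
      have "?q dvd x k - y k" for k
        using dvd_add[OF 3[of k] key[OF 2, of k]] by (simp add: algebra_simps)
      then show "reduce ?q x = reduce ?q y" unfolding reduce_eq_iff by blast
    qed
  qed
  also have "g ` adjoin M v = range (\<lambda>t. t * int p ^ a mod ?q) \<times> reduce ?q ` M"
  proof (intro equalityI subsetI)
    fix z assume "z \<in> g ` adjoin M v"
    then obtain x t where "z = g x" "x - scale t v \<in> M" by (auto simp: adjoin_def)
    then show "z \<in> range (\<lambda>t. t * int p ^ a mod ?q) \<times> reduce ?q ` M"
      using coord[of x t] by (auto simp: g_def)
  next
    fix z assume "z \<in> range (\<lambda>t. t * int p ^ a mod ?q) \<times> reduce ?q ` M"
    then obtain t m where z: "z = (t * int p ^ a mod ?q, reduce ?q m)" "m \<in> M" by auto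
    have mem: "(m + scale t v) - scale t v \<in> M" using z by simp
    have "g (m + scale t v) = z"
      unfolding g_def coord(2)[OF mem] unfolding coord(1)[OF mem] z by simp
    with mem show "z \<in> g ` adjoin M v" unfolding adjoin_def by blast
  qed
  also have "card \<dots> = p ^ (j - a) * card (reduce ?q ` M)"
    by (simp add: card_cartesian_product card_multiples_mod p)
  finally show ?thesis .
qed

lemma submodule_of_diag_lattice: "submodule_of I (diag_lattice I d)"
  by (auto simp: pointwise submodule_of_def diag_lattice_def intvecs_def)

definition unit_at :: "nat \<Rightarrow> nat \<Rightarrow> int" where
  "unit_at i = (\<lambda>k. if k = i then 1 else 0)"

lemma diag_lattice_insert:
  assumes "i \<notin> I"
  shows "diag_lattice (insert i I) d = adjoin (diag_lattice I d) (scale (d i) (unit_at i))"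
proof (intro equalityI subsetI)
  fix x assume x: "x \<in> diag_lattice (insert i I) d"
  then obtain t where "x i = d i * t" by (auto simp: diag_lattice_def dvd_def)
  then have "x - scale t (scale (d i) (unit_at i)) \<in> diag_lattice I d"
    using x assms by (auto simp: diag_lattice_def intvecs_def unit_at_def pointwise)
  then show "x \<in> adjoin (diag_lattice I d) (scale (d i) (unit_at i))" by (auto simp: adjoin_def)
next
  fix x assume "x \<in> adjoin (diag_lattice I d) (scale (d i) (unit_at i))"
  then obtain t where t: "x - scale t (scale (d i) (unit_at i)) \<in> diag_lattice I d"
    by (auto simp: adjoin_def)
  have other: "x - scale t (scale (d i) (unit_at i)) = (\<lambda>k. if k = i then x i - t * d i else x k)"
    by (auto simp: unit_at_def pointwise)
  have "x i = d i * t"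
    using t[unfolded other] assms by (auto simp: pointwise diag_lattice_def intvecs_def)
  then show "x \<in> diag_lattice (insert i I) d"
    using t[unfolded other] assms by (auto simp: pointwise diag_lattice_def intvecs_def split: if_splits)
qed

lemma card_reduce_diag_lattice:
  assumes "p > 0" "finite I"
  shows "card (reduce (int p ^ j) ` diag_lattice I (\<lambda>i. int p ^ e i)) = p ^ (\<Sum>i\<in>I. j - e i)"
  using assms(2)
proof induction
  case empty
  have "diag_lattice {} (\<lambda>i. int p ^ e i) = {0}"
    by (auto simp: pointwise diag_lattice_def intvecs_def)
  then show ?case by simp
next
  case (insert i I)
  have "card (reduce (int p ^ j) ` diag_lattice (insert i I) (\<lambda>i. int p ^ e i)) =
    p ^ (j - e i) * card (reduce (int p ^ j) ` diag_lattice I (\<lambda>i. int p ^ e i))"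
    unfolding diag_lattice_insert[OF insert(2)]
    by (rule card_reduce_adjoin[OF assms(1) submodule_of_diag_lattice])
       (use insert in \<open>auto simp: pointwise unit_at_def diag_lattice_def intvecs_def\<close>)
  then show ?case using insert by (simp add: power_add)
qed

text \<open>
The index of \<open>M\<close> in \<open>W\<close> is computed in the finite quotient modulo \<open>q\<close>, where each coset of \<open>M\<close>
has as many points as \<open>M\<close> itself.  The function \<open>F\<close> stands for any description of the cosets.
\<close>

lemma card_cosets_reduce:
  assumes M: "submodule_of I M" and W: "submodule_of I W" and "M \<subseteq> W"
    and N: "\<And>x. x \<in> intvecs I \<Longrightarrow> scale q x \<in> M"
    and fin: "finite (reduce q ` W)"
    and F: "\<And>w w'. w \<in> W \<Longrightarrow> w' \<in> W \<Longrightarrow> F w = F w' \<longleftrightarrow> w - w' \<in> M"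
  shows "finite (F ` W)" "card (F ` W) * card (reduce q ` M) = card (reduce q ` W)"
proof -
  define C where "C = reduce q ` W"
  have red: "x - reduce q x \<in> M" if "x \<in> intvecs I" for x
  proof -
    have "x - reduce q x = scale q (\<lambda>i. x i div q)"
      by (auto simp: pointwise reduce_def fun_eq_iff minus_mod_eq_mult_div)
    moreover have "(\<lambda>i. x i div q) \<in> intvecs I" using that by (simp add: intvecs_def)
    ultimately show ?thesis using N by simp
  qed
  have redW: "reduce q w \<in> W" if "w \<in> W" for w
    using submodule_of_diff[OF W that] red[OF submodule_of_intvecs[OF W that]] \<open>M \<subseteq> W\<close>
    by fastforce
  have redF: "F (reduce q w) = F w" if "w \<in> W" for w
    using F[OF that redW[OF that]] red[OF submodule_of_intvecs[OF W that]] by simp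
  have CW: "C \<subseteq> W" using redW by (auto simp: C_def)
  have FC: "F ` W = F ` C" by (force simp: C_def image_image redF)
  have finC: "finite C" using fin by (simp add: C_def)
  show "finite (F ` W)" using finC FC by simp
  have fib: "card {c \<in> C. F c = y} = card (reduce q ` M)" if "y \<in> F ` C" for y
  proof -
    obtain c0 where c0: "c0 \<in> C" "y = F c0" using \<open>y \<in> F ` C\<close> by auto
    have "{c \<in> C. F c = y} = (\<lambda>m. reduce q (c0 + m)) ` M"
    proof (intro equalityI subsetI)
      fix c assume "c \<in> {c \<in> C. F c = y}"
      then have c: "c \<in> C" "c - c0 \<in> M" using F CW c0 by auto
      obtain w where "c = reduce q w" using c by (auto simp: C_def)
      then have "c = reduce q (c0 + (c - c0))" by (simp add: pointwise reduce_def)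
      then show "c \<in> (\<lambda>m. reduce q (c0 + m)) ` M" using c by blast
    next
      fix c assume "c \<in> (\<lambda>m. reduce q (c0 + m)) ` M"
      then obtain m where m: "m \<in> M" "c = reduce q (c0 + m)" by auto
      have W': "c0 + m \<in> W" using submodule_of_add[OF W] c0 CW m \<open>M \<subseteq> W\<close> by blast
      have "F c = F (c0 + m)" using redF[OF W'] m by simp
      also have "\<dots> = F c0" using F[OF W'] c0 CW m by auto
      finally show "c \<in> {c \<in> C. F c = y}" using W' m c0 by (auto simp: C_def)
    qed
    also have "card \<dots> = card (reduce q ` M)"
      by (rule card_image_same_kernel) (simp add: pointwise reduce_eq_iff)
    finally show ?thesis .
  qed
  have "card C = (\<Sum>y\<in>F ` C. card {c \<in> C. F c = y})"
    using sum.image_gen[OF finC, of "\<lambda>_. 1::nat" F] by simp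
  also have "\<dots> = card (F ` C) * card (reduce q ` M)" using fib by simp
  finally show "card (F ` W) * card (reduce q ` M) = card (reduce q ` W)"
    by (simp add: FC C_def)
qed

lemma has_type_submodule: "has_type p I \<alpha> H \<Longrightarrow> submodule_of I H"
  by (simp add: has_type_def)

lemma has_type_card: "has_type p I \<alpha> H \<Longrightarrow> card (reduce (int p ^ j) ` H) = p ^ (\<Sum>a\<leftarrow>\<alpha>. j - a)"
  by (simp add: has_type_def)

lemma has_type_contains_multiples:
  assumes "has_type p I \<alpha> H"
  shows "\<exists>N. \<forall>M\<ge>N. \<forall>x\<in>intvecs I. scale (int p ^ M) x \<in> H"
proof -
  obtain N where N: "\<And>x. x \<in> intvecs I \<Longrightarrow> scale (int p ^ N) x \<in> H"
    using assms by (auto simp: has_type_def)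
  have "scale (int p ^ M) x \<in> H" if "N \<le> M" "x \<in> intvecs I" for M x
  proof -
    have "scale (int p ^ M) x = scale (int p ^ N) (scale (int p ^ (M - N)) x)"
      using that(1) by (auto simp: pointwise mult.assoc[symmetric] simp flip: power_add)
    moreover have "scale (int p ^ (M - N)) x \<in> intvecs I"
      using that(2) by (simp add: pointwise intvecs_def)
    ultimately show ?thesis using N by metis
  qed
  then show ?thesis by blast
qed

section \<open>Splitting off one coordinate\<close>

text \<open>
The numerical condition is the product formula for adjoining a vector.  The multiple of \<open>\<int>\<^sup>I\<close>
inside the new lattice comes from \<open>p ^ a x - x\<^sub>i v\<close>, which has no \<open>i\<close>-th coordinate.
\<close>

lemma has_type_adjoin:
  assumes p: "p > 0" and i: "i \<in> I" and M: "has_type p (I - {i}) \<alpha> M"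
    and v: "v \<in> intvecs I" "v i = int p ^ a" "\<And>k. int p ^ a dvd v k"
  shows "has_type p I (a # \<alpha>) (adjoin M v)"
  unfolding has_type_def
proof (intro conjI allI)
  note sM = has_type_submodule[OF M]
  have M0: "x i = 0" if "x \<in> M" for x
    using submodule_of_intvecs[OF sM that] by (auto simp: intvecs_def)
  show "submodule_of I (adjoin M v)"
    unfolding submodule_of_def
  proof (intro conjI ballI subsetI)
    fix x assume "x \<in> adjoin M v"
    then obtain t where "x - scale t v \<in> M" by (auto simp: adjoin_def)
    then have "x - scale t v \<in> intvecs (I - {i})" using submodule_of_intvecs[OF sM] by blast
    then show "x \<in> intvecs I" using v(1) by (auto simp: pointwise intvecs_def)
  next
    have "0 - scale 0 v \<in> M" using submodule_of_zero[OF sM] by simp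
    then show "0 \<in> adjoin M v" unfolding adjoin_def by blast
  next
    fix x y assume "x \<in> adjoin M v" "y \<in> adjoin M v"
    then obtain t s where ts: "x - scale t v \<in> M" "y - scale s v \<in> M" by (auto simp: adjoin_def)
    have "(x - y) - scale (t - s) v = (x - scale t v) - (y - scale s v)"
      by (auto simp: pointwise algebra_simps)
    then have "(x - y) - scale (t - s) v \<in> M" using submodule_of_diff[OF sM ts] by metis
    then show "x - y \<in> adjoin M v" unfolding adjoin_def by blast
  qed
  obtain N where N: "\<And>x. x \<in> intvecs (I - {i}) \<Longrightarrow> scale (int p ^ N) x \<in> M"
    using M by (auto simp: has_type_def)
  show "\<exists>N. \<forall>x\<in>intvecs I. scale (int p ^ N) x \<in> adjoin M v"
  proof (intro exI ballI)
    fix x assume x: "x \<in> intvecs I"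
    define y where "y = (\<lambda>k. int p ^ a * x k - x i * v k)"
    have "y \<in> intvecs (I - {i})" using x v i by (auto simp: pointwise y_def intvecs_def)
    then have "scale (int p ^ N) y \<in> M" by (rule N)
    moreover have "scale (int p ^ (N + a)) x - scale (int p ^ N * x i) v = scale (int p ^ N) y"
      by (auto simp: pointwise y_def algebra_simps power_add)
    ultimately have "scale (int p ^ (N + a)) x - scale (int p ^ N * x i) v \<in> M" by simp
    then show "scale (int p ^ (N + a)) x \<in> adjoin M v" unfolding adjoin_def by blast
  qed
  fix j
  have "card (reduce (int p ^ j) ` adjoin M v) = p ^ (j - a) * card (reduce (int p ^ j) ` M)"
    by (rule card_reduce_adjoin[where i = i, OF p sM]) (use M0 v in auto)
  then show "card (reduce (int p ^ j) ` adjoin M v) = p ^ (\<Sum>b\<leftarrow>a # \<alpha>. j - b)"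
    by (simp add: has_type_card[OF M] power_add)
qed

lemma slice_adjoin:
  assumes "\<And>x. x \<in> M \<Longrightarrow> x i = 0" "v i \<noteq> 0"
  shows "{x \<in> adjoin M v. x i = 0} = M"
proof (intro equalityI subsetI)
  fix x assume "x \<in> {x \<in> adjoin M v. x i = 0}"
  then obtain t where t: "x - scale t v \<in> M" "x i = 0" by (auto simp: adjoin_def)
  then have "t = 0" using assms(1)[OF t(1)] assms(2) by (simp add: pointwise)
  then show "x \<in> M" using t by simp
next
  fix x assume "x \<in> M"
  then have "x - scale 0 v \<in> M" by simp
  then show "x \<in> {x \<in> adjoin M v. x i = 0}" using assms(1) \<open>x \<in> M\<close> unfolding adjoin_def by blast
qed

text \<open>
The image of \<open>H\<close> modulo \<open>p ^ a\<close> has \<open>p ^ 0 = 1\<close> element, as all truncated differences \<open>a - b\<close> vanish.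
\<close>

lemma has_type_dvd:
  assumes H: "has_type p I \<alpha> H" and a: "\<And>b. b \<in> set \<alpha> \<Longrightarrow> a \<le> b" and x: "x \<in> H"
  shows "int p ^ a dvd x i"
proof -
  have "(\<Sum>b\<leftarrow>\<alpha>. a - b) = 0" using a by (simp add: sum_list_eq_0_iff)
  then have "card (reduce (int p ^ a) ` H) = 1" using has_type_card[OF H, of a] by simp
  then obtain z where "reduce (int p ^ a) ` H = {z}" by (auto simp: card_1_singleton_iff)
  then have "reduce (int p ^ a) x = reduce (int p ^ a) 0"
    using x submodule_of_zero[OF has_type_submodule[OF H]] by (metis imageI singletonD)
  then have "\<forall>i. int p ^ a dvd x i - 0" unfolding reduce_eq_iff by (simp add: pointwise)
  then show ?thesis by simp
qed

text \<open>
Otherwise the image of \<open>H\<close> modulo \<open>p ^ (a + 1)\<close> would be trivial, but its cardinality is a multiple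
of \<open>p\<close>.
\<close>

lemma has_type_exists_pivot:
  assumes p: "prime p" and H: "has_type p I (a # \<alpha>) H"
  shows "\<exists>x\<in>H. \<exists>i\<in>I. \<not> int p ^ Suc a dvd x i"
proof (rule ccontr)
  assume "\<not> ?thesis"
  then have *: "int p ^ Suc a dvd x i" if "x \<in> H" "i \<in> I" for x i using that by blast
  have "int p ^ Suc a dvd x i" if "x \<in> H" for x i
  proof (cases "i \<in> I")
    case False
    then have "x i = 0" using submodule_of_intvecs[OF has_type_submodule[OF H] that]
      by (auto simp: pointwise intvecs_def)
    then show ?thesis by simp
  qed (use * that in blast)
  then have "reduce (int p ^ Suc a) x = 0" if "x \<in> H" for x
    using that by (intro ext) (simp add: pointwise reduce_def dvd_imp_mod_0 del: power_Suc)
  then have "reduce (int p ^ Suc a) ` H \<subseteq> {0}" by blast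
  from card_mono[OF _ this] have "card (reduce (int p ^ Suc a) ` H) \<le> 1" by simp
  moreover have "card (reduce (int p ^ Suc a) ` H) = p * p ^ (\<Sum>b\<leftarrow>\<alpha>. Suc a - b)"
    using has_type_card[OF H, of "Suc a"] by simp
  moreover have "p * p ^ (\<Sum>b\<leftarrow>\<alpha>. Suc a - b) \<ge> p" using prime_gt_0_nat[OF p] by simp
  ultimately show False using prime_gt_1_nat[OF p] by linarith
qed

text \<open>
The \<open>i\<close>-th entry of \<open>x\<close> is \<open>p ^ a t\<close> with \<open>t\<close> prime to \<open>p\<close>.  Adding to a multiple of \<open>x\<close> a vector from
\<open>p ^ N \<int>\<^sup>I \<subseteq> H\<close> turns it into exactly \<open>p ^ a\<close>, and the resulting \<open>v\<close> clears coordinate \<open>i\<close> of every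
other vector of \<open>H\<close>.  The type of the slice follows by cancelling a factor from the product formula.
\<close>

lemma has_type_split_off:
  assumes p: "prime p" and H: "has_type p I (a # \<alpha>) H" and i: "i \<in> I"
    and dvd_H: "\<forall>x\<in>H. \<forall>k. int p ^ a dvd x k"
    and x: "x \<in> H" "\<not> int p ^ Suc a dvd x i"
  obtains v where "v \<in> H" "v i = int p ^ a" "H = adjoin {y \<in> H. y i = 0} v"
    "has_type p (I - {i}) \<alpha> {y \<in> H. y i = 0}"
proof -
  have dvd: "int p ^ a dvd x k" if "x \<in> H" for x k using dvd_H that by blast
  define M where "M = {y \<in> H. y i = 0}"
  note sH = has_type_submodule[OF H]
  have p0: "p > 0" using p prime_gt_0_nat by blast
  obtain N where N: "\<And>x. x \<in> intvecs I \<Longrightarrow> scale (int p ^ N) x \<in> H"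
    using H by (auto simp: has_type_def)
  obtain t where t: "x i = int p ^ a * t" using dvd[OF x(1)] by (auto simp: dvd_def)
  have "\<not> int p dvd t" using x(2) t by (auto simp: dvd_def)
  then have "coprime t (int p ^ N)"
    using p by (metis coprime_commute coprime_power_left_iff prime_imp_coprime prime_nat_int_transfer)
  then obtain r w where rw: "r * t + w * int p ^ N = 1" using bezout_int[of t "int p ^ N"] by auto
  \<comment> \<open>The Bezout coefficients \<open>r\<close> and \<open>w\<close> are chosen so that the \<open>i\<close>-th entry becomes \<open>p ^ a\<close>.\<close>
  define v where "v = scale r x + scale (int p ^ N) (scale (w * int p ^ a) (unit_at i))"
  have vH: "v \<in> H" unfolding v_def
    by (intro submodule_of_add[OF sH] submodule_of_scale[OF sH] x N) (use i in \<open>auto simp: pointwise intvecs_def unit_at_def\<close>)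
  have "v i = int p ^ a * (r * t + w * int p ^ N)" by (simp add: pointwise v_def unit_at_def t algebra_simps)
  then have vi: "v i = int p ^ a" using rw by simp
  have adjoin: "H = adjoin M v"
  proof (intro equalityI subsetI)
    fix y assume y: "y \<in> H"
    obtain s where s: "y i = int p ^ a * s" using dvd[OF y] by (auto simp: dvd_def)
    have "y - scale s v \<in> M" unfolding M_def
      using submodule_of_diff[OF sH y submodule_of_scale[OF sH vH, of s]] s vi by (simp add: pointwise)
    then show "y \<in> adjoin M v" unfolding adjoin_def by blast
  next
    fix y assume "y \<in> adjoin M v"
    then obtain s where "y - scale s v \<in> H" by (auto simp: adjoin_def M_def)
    then show "y \<in> H" using submodule_of_add[OF sH _ submodule_of_scale[OF sH vH, of s]] by fastforce
  qed
  have sM: "submodule_of (I - {i}) M"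
    unfolding submodule_of_def
  proof (intro conjI ballI subsetI)
    show "y \<in> intvecs (I - {i})" if "y \<in> M" for y
      using that submodule_of_intvecs[OF sH] by (auto simp: pointwise M_def intvecs_def)
    show "0 \<in> M" using submodule_of_zero[OF sH] by (simp add: pointwise M_def)
    show "y - z \<in> M" if "y \<in> M" "z \<in> M" for y z
      using that submodule_of_diff[OF sH] by (simp add: pointwise M_def)
  qed
  have "has_type p (I - {i}) \<alpha> M"
    unfolding has_type_def
  proof (intro conjI allI)
    show "\<exists>N. \<forall>x\<in>intvecs (I - {i}). scale (int p ^ N) x \<in> M"
    proof (intro exI ballI)
      show "scale (int p ^ N) y \<in> M" if "y \<in> intvecs (I - {i})" for y
        using that N[of y] by (auto simp: pointwise M_def intvecs_def)
    qed
    fix j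
    have "p ^ (j - a) * card (reduce (int p ^ j) ` M) = card (reduce (int p ^ j) ` H)"
      unfolding adjoin by (rule card_reduce_adjoin[where p = p and a = a and M = M and i = i and v = v, OF p0 sM _ vi, symmetric])
        (use dvd[OF vH] in \<open>auto simp: pointwise M_def\<close>)
    also have "\<dots> = p ^ (j - a) * p ^ (\<Sum>b\<leftarrow>\<alpha>. j - b)"
      using has_type_card[OF H, of j] by (simp add: power_add)
    finally show "card (reduce (int p ^ j) ` M) = p ^ (\<Sum>b\<leftarrow>\<alpha>. j - b)" using p0 by simp
  qed (rule sM)
  then show ?thesis using that[OF vH vi adjoin[unfolded M_def]] unfolding M_def by blast
qed

section \<open>Counting by a Pascal type recursion\<close>

text \<open>
The recursion counts the lattices of a given type inside this one; replacing \<open>J\<close> by \<open>insert i J\<close>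
tightens the condition on a single coordinate.
\<close>

definition frame :: "nat \<Rightarrow> nat set \<Rightarrow> nat set \<Rightarrow> nat \<Rightarrow> (nat \<Rightarrow> int) set" where
  "frame p I J a = diag_lattice I (\<lambda>i. int p ^ (if i \<in> J then Suc a else a))"

definition typed_in_frame ::
  "nat \<Rightarrow> nat set \<Rightarrow> nat set \<Rightarrow> nat \<Rightarrow> nat list \<Rightarrow> (nat \<Rightarrow> int) set set" where
  "typed_in_frame p I J a \<alpha> = {H. has_type p I \<alpha> H \<and> H \<subseteq> frame p I J a}"

lemma frame_iff:
  "x \<in> frame p I J a \<longleftrightarrow> x \<in> intvecs I \<and> (\<forall>k\<in>I. int p ^ (if k \<in> J then Suc a else a) dvd x k)"
  by (simp add: frame_def diag_lattice_def)

lemma frame_dvd: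
  assumes "x \<in> frame p I J a"
  shows "int p ^ a dvd x k"
proof (cases "k \<in> I")
  case True
  have "int p ^ a dvd int p ^ (if k \<in> J then Suc a else a)" by (intro le_imp_power_dvd) simp
  also have "\<dots> dvd x k" using assms True unfolding frame_iff by blast
  finally show ?thesis .
next
  case False
  then show ?thesis using assms by (simp add: frame_iff intvecs_def)
qed

lemma frame_insert_iff:
  assumes "i \<in> I"
  shows "x \<in> frame p I (insert i J) a \<longleftrightarrow> x \<in> frame p I J a \<and> int p ^ Suc a dvd x i"
proof -
  have "int p ^ a dvd x i" if "int p ^ Suc a dvd x i"
    using that by (metis dvd_trans le_imp_power_dvd le_SucI le_refl)
  then have "int p ^ (if k \<in> insert i J then Suc a else a) dvd x k \<longleftrightarrow>
      int p ^ (if k \<in> J then Suc a else a) dvd x k \<and> (k = i \<longrightarrow> int p ^ Suc a dvd x i)" for k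
    by (cases "k = i") auto
  then show ?thesis unfolding frame_iff using assms by blast
qed

lemma submodule_of_frame: "submodule_of I (frame p I J a)"
  unfolding frame_def by (rule submodule_of_diag_lattice)

text \<open>
The lattices with a given slice \<open>M\<close> at coordinate \<open>i\<close> and a pivot \<open>p ^ a\<close> there are obtained by
adjoining \<open>p ^ a e\<^sub>i + w\<close> with \<open>w\<close> in the frame of the remaining coordinates, and two choices of \<open>w\<close>
give the same lattice exactly if they differ by an element of \<open>M\<close>.  So their number is the index
of \<open>M\<close> in that frame.  Among all vectors supported on \<open>I - {i}\<close> the frame has index
\<open>p ^ (a * length \<alpha> + card J)\<close> and \<open>M\<close> has index \<open>p ^ sum_list \<alpha>\<close>.
\<close>

lemma extensions_of_slice:
  fixes p a i :: nat and M :: "(nat \<Rightarrow> int) set"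
  defines "F \<equiv> \<lambda>w. adjoin M (scale (int p ^ a) (unit_at i) + w)"
  assumes p: "prime p" and fin: "finite I" and J: "J \<subseteq> I" and i: "i \<in> I - J"
    and len: "card I = Suc (length \<alpha>)"
    and M: "M \<in> typed_in_frame p (I - {i}) J a \<alpha>"
  shows "w \<in> frame p (I - {i}) J a \<Longrightarrow>
      F w \<in> typed_in_frame p I J a (a # \<alpha>) - typed_in_frame p I (insert i J) a (a # \<alpha>)"
    and "w \<in> frame p (I - {i}) J a \<Longrightarrow> {x \<in> F w. x i = 0} = M"
    and "finite (F ` frame p (I - {i}) J a)"
    and "card (F ` frame p (I - {i}) J a) = p ^ (sum_list \<alpha> - (a * length \<alpha> + card J))"
proof -
  let ?W = "frame p (I - {i}) J a"
  let ?v = "\<lambda>w. scale (int p ^ a) (unit_at i) + w"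
  have p0: "p > 0" using p prime_gt_0_nat by blast
  have tM: "has_type p (I - {i}) \<alpha> M" and MW: "M \<subseteq> ?W" using M by (auto simp: typed_in_frame_def)
  note sM = has_type_submodule[OF tM] and sW = submodule_of_frame[of "I - {i}" p J a]
  have W0: "x i = 0" if "x \<in> ?W" for x
    using submodule_of_intvecs[OF sW that] by (auto simp: intvecs_def)
  have M0: "x i = 0" if "x \<in> M" for x using W0 that MW by blast
  have WI: "?W \<subseteq> frame p I J a" using i by (auto simp: frame_def diag_lattice_def intvecs_def)
  have vi: "?v w i = int p ^ a" if "w \<in> ?W" for w using W0[OF that] by (simp add: pointwise unit_at_def)
  have vI: "?v w \<in> frame p I J a" if "w \<in> ?W" for w
  proof (rule submodule_of_add[OF submodule_of_frame])
    show "scale (int p ^ a) (unit_at i) \<in> frame p I J a"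
      using i by (auto simp: frame_def diag_lattice_def intvecs_def unit_at_def pointwise)
  qed (use that WI in blast)
  have inF: "?v w \<in> F w" for w
  proof -
    have "?v w - scale 1 (?v w) \<in> M" using submodule_of_zero[OF sM] by simp
    then show ?thesis unfolding F_def adjoin_def by blast
  qed
  show slice: "{x \<in> F w. x i = 0} = M" if "w \<in> ?W" for w
    unfolding F_def by (rule slice_adjoin[OF M0]) (use vi[OF that] p0 in auto)
  show "F w \<in> typed_in_frame p I J a (a # \<alpha>) - typed_in_frame p I (insert i J) a (a # \<alpha>)"
    if w: "w \<in> ?W" for w
  proof -
    have "has_type p I (a # \<alpha>) (F w)"
      unfolding F_def
      by (rule has_type_adjoin[where p = p and a = a and M = M and i = i and v = "?v w", OF p0 _ tM _ vi[OF w] frame_dvd[OF vI[OF w]]])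
         (use i submodule_of_intvecs[OF submodule_of_frame vI[OF w]] in auto)
    moreover have "F w \<subseteq> frame p I J a"
    proof
      fix x assume "x \<in> F w"
      then obtain t where "x - scale t (?v w) \<in> M" by (auto simp: F_def adjoin_def)
      then have "x - scale t (?v w) \<in> frame p I J a" using MW WI by blast
      from submodule_of_add[OF submodule_of_frame this submodule_of_scale[OF submodule_of_frame vI[OF w], of t]]
      show "x \<in> frame p I J a" by simp
    qed
    moreover have "\<not> p ^ Suc a dvd p ^ a"
      using power_dvd_imp_le[of p "Suc a" a] prime_gt_1_nat[OF p] by fastforce
    then have "\<not> int p ^ Suc a dvd ?v w i"
      unfolding vi[OF w] by (simp only: of_nat_power[symmetric] int_dvd_int_iff not_False_eq_True)
    then have "\<not> F w \<subseteq> frame p I (insert i J) a"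
      using inF[of w] frame_insert_iff[of i I "?v w" p J a] i by blast
    ultimately show ?thesis by (simp add: typed_in_frame_def)
  qed
  have ker: "F w = F w' \<longleftrightarrow> w - w' \<in> M" if w: "w \<in> ?W" "w' \<in> ?W" for w w'
  proof
    assume "F w = F w'"
    then have "?v w \<in> F w'" using inF[of w] by simp
    then obtain t where t: "?v w - scale t (?v w') \<in> M" by (auto simp: F_def adjoin_def)
    have "int p ^ a - t * int p ^ a = 0" using M0[OF t] vi[OF w(1)] vi[OF w(2)] by (simp add: pointwise)
    then have "t = 1" using p0 by simp
    then show "w - w' \<in> M" using t by simp
  next
    assume d: "w - w' \<in> M"
    have sub: "x \<in> F u'" if u: "u - u' \<in> M" and x: "x \<in> F u" for x u u'
    proof -
      obtain t where t: "x - scale t (?v u) \<in> M" using x by (auto simp: F_def adjoin_def)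
      have "x - scale t (?v u') = (x - scale t (?v u)) + scale t (u - u')"
        by (auto simp: pointwise algebra_simps)
      then have "x - scale t (?v u') \<in> M"
        using submodule_of_add[OF sM t submodule_of_scale[OF sM u, of t]] by metis
      then show ?thesis unfolding F_def adjoin_def by blast
    qed
    have d': "w' - w \<in> M" using submodule_of_uminus[OF sM d] by simp
    show "F w = F w'"
    proof (rule equalityI; rule subsetI)
      show "x \<in> F w'" if "x \<in> F w" for x by (rule sub[OF d that])
      show "x \<in> F w" if "x \<in> F w'" for x by (rule sub[OF d' that])
    qed
  qed
  obtain N0 where N0: "\<forall>N\<ge>N0. \<forall>x\<in>intvecs (I - {i}). scale (int p ^ N) x \<in> M"
    using has_type_contains_multiples[OF tM] ..
  \<comment> \<open>So large that \<open>p ^ N\<close> kills the quotient by \<open>M\<close> and that none of the subtractions below is truncated.\<close>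
  define N where "N = N0 + Suc a + sum_list \<alpha>"
  have N_ge: "N0 \<le> N" "Suc a \<le> N" "sum_list \<alpha> \<le> N" by (simp_all add: N_def)
  have cW: "card (reduce (int p ^ N) ` ?W) = p ^ (\<Sum>k\<in>I - {i}. N - (if k \<in> J then Suc a else a))"
    unfolding frame_def using fin by (intro card_reduce_diag_lattice p0) simp
  have finW: "finite (reduce (int p ^ N) ` ?W)"
    by (rule card_ge_0_finite) (use cW p0 in simp)
  note cosets = card_cosets_reduce[OF sM sW MW _ finW, of "F"]
  have N: "scale (int p ^ N) x \<in> M" if "x \<in> intvecs (I - {i})" for x
    using N0 N_ge(1) that by blast
  show finF: "finite (F ` ?W)" using cosets(1)[OF N ker] by blast
  define E1 where "E1 = (\<Sum>k\<in>I - {i}. N - (if k \<in> J then Suc a else a))"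
  define E2 where "E2 = (\<Sum>b\<leftarrow>\<alpha>. N - b)"
  have prod: "card (F ` ?W) * p ^ E2 = p ^ E1"
    using cosets(2)[OF N ker] has_type_card[OF tM, of N] cW by (simp add: E1_def E2_def)
  have cI: "card (I - {i}) = length \<alpha>" using len i fin by simp
  have "(\<Sum>k\<in>I - {i}. if k \<in> J then Suc a else a) = a * length \<alpha> + card J"
  proof -
    have "(\<Sum>k\<in>I - {i}. if k \<in> J then Suc a else a) = (\<Sum>k\<in>I - {i}. a + (if k \<in> J then 1 else 0))"
      by (intro sum.cong) auto
    also have "\<dots> = a * length \<alpha> + card {k \<in> I - {i}. k \<in> J}"
      using fin by (simp add: sum.distrib cI flip: sum.inter_filter)
    also have "{k \<in> I - {i}. k \<in> J} = J" using J i by auto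
    finally show ?thesis .
  qed
  moreover have "E1 + (\<Sum>k\<in>I - {i}. if k \<in> J then Suc a else a) = N * length \<alpha>"
    unfolding E1_def sum.distrib[symmetric] using cI by (subst sum.cong[OF refl, of _ _ "\<lambda>_. N"]) (use N_ge(2) in auto)
  ultimately have e1: "E1 + (a * length \<alpha> + card J) = N * length \<alpha>" by simp
  have "(\<Sum>b\<leftarrow>\<beta>. N - b) + sum_list \<beta> = N * length \<beta>" if "set \<beta> \<subseteq> set \<alpha>" for \<beta>
    using that
  proof (induction \<beta>)
    case (Cons b \<beta>)
    have "b \<le> N" using Cons.prems member_le_sum_list[of b \<alpha>] N_ge(3) by simp
    then show ?case using Cons by simp
  qed simp
  then have e2: "E2 + sum_list \<alpha> = N * length \<alpha>" by (simp add: E2_def)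
  have "card (F ` ?W) > 0"
    using prod p0 by (metis mult_0 gr_zeroI power_not_zero neq0_conv)
  then have "p ^ E2 \<le> p ^ E1" using prod by (metis One_nat_def Suc_leI mult_le_mono1 nat_mult_1)
  then have "E2 \<le> E1" using prime_gt_1_nat[OF p] by simp
  then have "card (F ` ?W) * p ^ E2 = p ^ (E1 - E2) * p ^ E2" using prod by (simp flip: power_add)
  then have "card (F ` ?W) = p ^ (E1 - E2)" using p0 by simp
  moreover have "E1 - E2 = sum_list \<alpha> - (a * length \<alpha> + card J)" using e1 e2 by linarith
  ultimately show "card (F ` ?W) = p ^ (sum_list \<alpha> - (a * length \<alpha> + card J))" by simp
qed

text \<open>
Either all vectors of the lattice have \<open>i\<close>-th entry divisible by \<open>p ^ (a + 1)\<close>, and then \<open>i\<close> can be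
added to \<open>J\<close>, or the lattice is an extension of its slice at \<open>i\<close>.
\<close>

lemma card_typed_in_frame_rec:
  assumes p: "prime p" and fin: "finite I" and J: "J \<subseteq> I" and i: "i \<in> I - J"
    and len: "card I = Suc (length \<alpha>)"
    and f1: "finite (typed_in_frame p I (insert i J) a (a # \<alpha>))"
    and f2: "finite (typed_in_frame p (I - {i}) J a \<alpha>)"
  shows "finite (typed_in_frame p I J a (a # \<alpha>))" (is ?fin)
    and "card (typed_in_frame p I J a (a # \<alpha>)) =
      card (typed_in_frame p I (insert i J) a (a # \<alpha>)) +
      p ^ (sum_list \<alpha> - (a * length \<alpha> + card J)) * card (typed_in_frame p (I - {i}) J a \<alpha>)" (is ?card)
proof -
  let ?S = "typed_in_frame p I J a (a # \<alpha>)"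
  let ?S1 = "typed_in_frame p I (insert i J) a (a # \<alpha>)"
  let ?T = "typed_in_frame p (I - {i}) J a \<alpha>"
  let ?W = "frame p (I - {i}) J a"
  let ?F = "\<lambda>M w. adjoin M (scale (int p ^ a) (unit_at i) + w)"
  note ext = extensions_of_slice[OF p fin J i len]
  define U where "U = (\<Union>M\<in>?T. ?F M ` ?W)"
  have iI: "i \<in> I" using i by simp
  have sub: "?S1 \<subseteq> ?S" using frame_insert_iff[OF iI] by (auto simp: typed_in_frame_def)
  have "?S - ?S1 = U"
  proof (intro equalityI subsetI)
    show "H \<in> ?S - ?S1" if "H \<in> U" for H using that ext(1) by (auto simp: U_def)
  next
    fix H assume H: "H \<in> ?S - ?S1"
    then have tH: "has_type p I (a # \<alpha>) H" and HF: "H \<subseteq> frame p I J a"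
      by (auto simp: typed_in_frame_def)
    have "\<not> H \<subseteq> frame p I (insert i J) a" using H by (auto simp: typed_in_frame_def)
    then obtain x where x: "x \<in> H" "\<not> int p ^ Suc a dvd x i" using frame_insert_iff[OF iI] HF by blast
    have "\<forall>y\<in>H. \<forall>k. int p ^ a dvd y k" using frame_dvd HF by blast
    then obtain v where v: "v \<in> H" "v i = int p ^ a" "H = adjoin {y \<in> H. y i = 0} v"
        "has_type p (I - {i}) \<alpha> {y \<in> H. y i = 0}"
      using has_type_split_off[OF p tH iI _ x] by blast
    have slice: "y \<in> ?W" if "y \<in> frame p I J a" "y i = 0" for y
      using that by (auto simp: frame_def diag_lattice_def intvecs_def)
    have "{y \<in> H. y i = 0} \<in> ?T" using v(4) slice HF by (auto simp: typed_in_frame_def)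
    moreover have "v - scale (int p ^ a) (unit_at i) \<in> ?W"
    proof -
      have "v \<in> frame p I J a" using HF v(1) by blast
      then show ?thesis using v(2) i by (auto simp: frame_def diag_lattice_def intvecs_def unit_at_def pointwise)
    qed
    moreover have "H = ?F {y \<in> H. y i = 0} (v - scale (int p ^ a) (unit_at i))" using v(3) by simp
    ultimately show "H \<in> U" unfolding U_def by blast
  qed
  then have S: "?S = ?S1 \<union> U" "?S1 \<inter> U = {}" using sub by auto
  have finU: "finite U" unfolding U_def using f2 ext(3) by blast
  show ?fin unfolding S(1) using f1 finU by simp
  have "card U = (\<Sum>M\<in>?T. card (?F M ` ?W))"
    unfolding U_def
  proof (rule card_UN_disjoint)
    show "\<forall>M\<in>?T. \<forall>M'\<in>?T. M \<noteq> M' \<longrightarrow> ?F M ` ?W \<inter> ?F M' ` ?W = {}"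
    proof (intro ballI impI equals0I)
      fix M M' H assume h: "M \<in> ?T" "M' \<in> ?T" "M \<noteq> M'" "H \<in> ?F M ` ?W \<inter> ?F M' ` ?W"
      then obtain w w' where w: "w \<in> ?W" "H = ?F M w" and w': "w' \<in> ?W" "H = ?F M' w'" by blast
      have "{x \<in> H. x i = 0} = M" unfolding w(2) by (rule ext(2)[OF h(1) w(1)])
      moreover have "{x \<in> H. x i = 0} = M'" unfolding w'(2) by (rule ext(2)[OF h(2) w'(1)])
      ultimately show False using h(3) by simp
    qed
  qed (use f2 ext(3) in auto)
  also have "\<dots> = p ^ (sum_list \<alpha> - (a * length \<alpha> + card J)) * card ?T"
    using ext(4) by simp
  finally show ?card using card_Un_disjoint[OF f1 finU S(2)] S(1) by simp
qed

lemma typed_in_frame_full: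
  assumes "prime p" shows "typed_in_frame p I I a (a # \<alpha>) = {}"
proof -
  have False if tH: "has_type p I (a # \<alpha>) H" and HF: "H \<subseteq> frame p I I a" for H
  proof -
    obtain x i where "x \<in> H" "i \<in> I" "\<not> int p ^ Suc a dvd x i"
      using has_type_exists_pivot[OF assms tH] by blast
    then show False using HF by (auto simp: frame_def diag_lattice_def simp del: power_Suc)
  qed
  then show ?thesis by (auto simp: typed_in_frame_def)
qed

text \<open>
For every lattice of type \<open>\<alpha>\<close> all entries are divisible by \<open>p ^ a'\<close>, hence by \<open>p ^ a\<close> and \<open>p ^ (a + 1)\<close>.
\<close>

lemma typed_in_frame_raise:
  assumes "\<And>b. b \<in> set \<alpha> \<Longrightarrow> a' \<le> b" "a < a'" 
  shows "typed_in_frame p I J a \<alpha> = typed_in_frame p I {} a' \<alpha>"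
proof -
  have "H \<subseteq> frame p I J a" "H \<subseteq> frame p I {} a'" if H: "has_type p I \<alpha> H" for H
  proof -
    have d: "int p ^ a' dvd x k" if "x \<in> H" for x k using has_type_dvd[OF H assms(1) that] .
    have "int p ^ a dvd x k \<and> int p ^ Suc a dvd x k" if "x \<in> H" for x k
      using d[OF that] assms(2) by (metis Suc_leI dvd_trans le_imp_power_dvd less_imp_le)
    then show "H \<subseteq> frame p I J a" "H \<subseteq> frame p I {} a'"
      using d submodule_of_intvecs[OF has_type_submodule[OF H]]
      by (auto simp: frame_def diag_lattice_def simp del: power_Suc)
  qed
  then show ?thesis by (auto simp: typed_in_frame_def)
qed

text \<open>
The count depends on \<open>I\<close> and \<open>J\<close> only through their cardinalities, and the polynomial \<open>g\<close> is chosen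
before \<open>p\<close>, \<open>I\<close> and \<open>J\<close>.  For a fixed head of \<open>\<alpha>\<close> the recursion is solved by descending
induction on \<open>s\<close>, starting from the full set of coordinates, where there is no such lattice.
\<close>

lemma card_typed_in_frame_polynomial:
  assumes "sorted \<alpha>" "\<And>b. b \<in> set \<alpha> \<Longrightarrow> a \<le> b" "s \<le> length \<alpha>"
  shows "\<exists>g :: int poly. \<forall>p I J. prime p \<longrightarrow> finite I \<longrightarrow> J \<subseteq> I \<longrightarrow>
    card I = length \<alpha> \<longrightarrow> card J = s \<longrightarrow> finite (typed_in_frame p I J a \<alpha>) \<and>
    int (card (typed_in_frame p I J a \<alpha>)) = poly g (int p)"
  using assms
proof (induction \<alpha> arbitrary: a s)
  case Nil
  have "typed_in_frame p {} {} a [] = {{0}}" for p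
  proof -
    have 0: "intvecs {} = {0}" by (auto simp: pointwise intvecs_def)
    have frame: "frame p {} {} a = {0}" by (simp add: frame_def diag_lattice_def 0)
    have "has_type p {} [] H \<and> H \<subseteq> {0} \<longleftrightarrow> H = {0}" for H
    proof
      assume "has_type p {} [] H \<and> H \<subseteq> {0}"
      then show "H = {0}" using submodule_of_zero[OF has_type_submodule, of p "{}" "[]" H] by blast
    next
      assume H: "H = {0}"
      have "scale (int p ^ N) 0 = 0" for N by (auto simp: pointwise)
      then have "has_type p {} [] H" unfolding has_type_def submodule_of_def 0 H by auto
      then show "has_type p {} [] H \<and> H \<subseteq> {0}" using H by blast
    qed
    then show ?thesis unfolding typed_in_frame_def frame by blast
  qed
  then show ?case by (intro exI[of _ 1]) auto
next
  case (Cons b \<alpha>)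
  let ?P = "\<lambda>s g. \<forall>p I J. prime p \<longrightarrow> finite I \<longrightarrow> J \<subseteq> I \<longrightarrow>
    card I = length (b # \<alpha>) \<longrightarrow> card J = s \<longrightarrow> finite (typed_in_frame p I J b (b # \<alpha>)) \<and>
    int (card (typed_in_frame p I J b (b # \<alpha>))) = poly g (int p)"
  have step: "\<exists>g :: int poly. ?P s g" if "s \<le> length (b # \<alpha>)" for s
    using that
  proof (induction rule: inc_induct)
    case base
    have "?P (length (b # \<alpha>)) 0"
    proof (intro allI impI)
      fix p :: nat and I J :: "nat set"
      assume h: "prime p" "finite I" "J \<subseteq> I" "card I = length (b # \<alpha>)" "card J = length (b # \<alpha>)"
      then have "J = I" using card_subset_eq by metis
      then have "typed_in_frame p I J b (b # \<alpha>) = {}" using typed_in_frame_full[OF h(1)] by simp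
      then show "finite (typed_in_frame p I J b (b # \<alpha>)) \<and>
          int (card (typed_in_frame p I J b (b # \<alpha>))) = poly 0 (int p)" by simp
    qed
    then show ?case by blast
  next
    case (step s)
    obtain g1 :: "int poly" where g1: "?P (Suc s) g1" using step.IH ..
    have "sorted \<alpha>" "\<And>c. c \<in> set \<alpha> \<Longrightarrow> b \<le> c" "s \<le> length \<alpha>"
      using Cons.prems(1) step.hyps by auto
    from Cons.IH[OF this] obtain g2 :: "int poly" where g2:
      "\<forall>p I J. prime p \<longrightarrow> finite I \<longrightarrow> J \<subseteq> I \<longrightarrow>
      card I = length \<alpha> \<longrightarrow> card J = s \<longrightarrow> finite (typed_in_frame p I J b \<alpha>) \<and>
      int (card (typed_in_frame p I J b \<alpha>)) = poly g2 (int p)" ..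
    define g where "g = g1 + monom 1 (sum_list \<alpha> - (b * length \<alpha> + s)) * g2"
    have "finite (typed_in_frame p I J b (b # \<alpha>)) \<and>
        int (card (typed_in_frame p I J b (b # \<alpha>))) = poly g (int p)"
      if h: "prime p" "finite I" "J \<subseteq> I" "card I = length (b # \<alpha>)" "card J = s" for p I J
    proof -
      have finJ: "finite J" using h(2,3) finite_subset by blast
      have "J \<noteq> I" using h step.hyps by auto
      then obtain i where i: "i \<in> I - J" using h(3) by blast
      have 1: "finite (typed_in_frame p I (insert i J) b (b # \<alpha>))"
          "int (card (typed_in_frame p I (insert i J) b (b # \<alpha>))) = poly g1 (int p)"
        using g1[rule_format, of p I "insert i J"] h i finJ by auto
      have 2: "finite (typed_in_frame p (I - {i}) J b \<alpha>)"
          "int (card (typed_in_frame p (I - {i}) J b \<alpha>)) = poly g2 (int p)"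
        using g2[rule_format, of p "I - {i}" J] h i by auto
      note rec = card_typed_in_frame_rec[OF h(1-3) i _ 1(1) 2(1)]
      show ?thesis using rec h(4,5) 1 2 by (simp add: g_def poly_monom)
    qed
    then show ?case by blast
  qed
  show ?case
  proof (cases "a = b")
    case True
    then show ?thesis using step[OF Cons.prems(3)] by simp
  next
    case False
    then have "a < b" using Cons.prems(2)[of b] by simp
    then have "typed_in_frame p I J a (b # \<alpha>) = typed_in_frame p I {} b (b # \<alpha>)" for p I J
      using Cons.prems(1) by (intro typed_in_frame_raise) auto
    then show ?thesis using step[of 0] by auto
  qed
qed

section \<open>Additive automorphisms and adapted coordinates\<close>

definition additive_bij ::
  "nat set \<Rightarrow> nat set \<Rightarrow> ((nat \<Rightarrow> int) \<Rightarrow> nat \<Rightarrow> int) \<Rightarrow> bool" where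
  "additive_bij I I' \<sigma> \<longleftrightarrow> bij_betw \<sigma> (intvecs I) (intvecs I') \<and>
     (\<forall>x\<in>intvecs I. \<forall>y\<in>intvecs I. \<sigma> (x + y) = \<sigma> x + \<sigma> y)"

lemma submodule_of_intvecs_self: "submodule_of I (intvecs I)"
  by (auto simp: submodule_of_def intvecs_def pointwise)

lemmas intvecs_closed =
  submodule_of_zero[OF submodule_of_intvecs_self]
  submodule_of_add[OF submodule_of_intvecs_self]
  submodule_of_diff[OF submodule_of_intvecs_self]
  submodule_of_uminus[OF submodule_of_intvecs_self]
  submodule_of_scale[OF submodule_of_intvecs_self]

lemma additive_bij_add:
  "additive_bij I I' \<sigma> \<Longrightarrow> x \<in> intvecs I \<Longrightarrow> y \<in> intvecs I \<Longrightarrow> \<sigma> (x + y) = \<sigma> x + \<sigma> y"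
  by (simp add: additive_bij_def)

lemma additive_bij_mem: "additive_bij I I' \<sigma> \<Longrightarrow> x \<in> intvecs I \<Longrightarrow> \<sigma> x \<in> intvecs I'"
  by (auto simp: additive_bij_def bij_betw_def)

lemma additive_bij_surj:
  "additive_bij I I' \<sigma> \<Longrightarrow> y \<in> intvecs I' \<Longrightarrow> \<exists>x\<in>intvecs I. y = \<sigma> x"
  by (metis additive_bij_def bij_betw_imp_surj_on imageE)

lemma additive_bij_zero:
  assumes "additive_bij I I' \<sigma>" shows "\<sigma> 0 = 0"
  using additive_bij_add[OF assms intvecs_closed(1) intvecs_closed(1)] by simp

lemma additive_bij_uminus:
  assumes "additive_bij I I' \<sigma>" "x \<in> intvecs I" shows "\<sigma> (- x) = - \<sigma> x"
proof -
  have "\<sigma> (x + - x) = \<sigma> x + \<sigma> (- x)"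
    by (rule additive_bij_add[OF assms intvecs_closed(4)[OF assms(2)]])
  then have "\<sigma> x + \<sigma> (- x) = 0" using additive_bij_zero[OF assms(1)] by simp
  then show ?thesis by (metis minus_unique)
qed

lemma additive_bij_diff:
  assumes "additive_bij I I' \<sigma>" "x \<in> intvecs I" "y \<in> intvecs I"
  shows "\<sigma> (x - y) = \<sigma> x - \<sigma> y"
  using additive_bij_add[OF assms(1,2) intvecs_closed(4)[OF assms(3)]]
    additive_bij_uminus[OF assms(1,3)] by simp

lemma additive_bij_scale:
  assumes s: "additive_bij I I' \<sigma>" and x: "x \<in> intvecs I"
  shows "\<sigma> (scale t x) = scale t (\<sigma> x)"
proof -
  have nat: "\<sigma> (scale (int k) x) = scale (int k) (\<sigma> x)" for k
  proof (induction k)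
    case 0
    show ?case by (simp only: of_nat_0 scale_zero additive_bij_zero[OF s])
  next
    case (Suc k)
    have split: "scale (int (Suc k)) y = scale (int k) y + y" for y
      by (auto simp: pointwise algebra_simps)
    show ?case
      unfolding split additive_bij_add[OF s intvecs_closed(5)[OF x] x] Suc ..
  qed
  show ?thesis
  proof (cases "t \<ge> 0")
    case True
    then show ?thesis using nat[of "nat t"] by simp
  next
    case False
    then have neg: "scale t y = - scale (int (nat (- t))) y" for y by (auto simp: pointwise)
    show ?thesis
      unfolding neg additive_bij_uminus[OF s intvecs_closed(5)[OF x]] nat ..
  qed
qed

text \<open>
Congruence modulo \<open>q\<close> means that the difference is \<open>q\<close> times a vector of the group, and this is
preserved and reflected by isomorphisms.
\<close>

lemma additive_bij_reduce:
  assumes s: "additive_bij I I' \<sigma>" and x: "x \<in> intvecs I" "y \<in> intvecs I"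
  shows "reduce q (\<sigma> x) = reduce q (\<sigma> y) \<longleftrightarrow> reduce q x = reduce q y"
proof -
  have div: "\<exists>z\<in>intvecs K. x = y + scale q z"
    if "reduce q x = reduce q y" "x \<in> intvecs K" "y \<in> intvecs K" for x y K
  proof (intro bexI)
    have "q dvd x i - y i" for i using that(1) by (simp add: reduce_eq_iff)
    then show "x = y + scale q (\<lambda>i. (x i - y i) div q)" by (auto simp: pointwise)
    show "(\<lambda>i. (x i - y i) div q) \<in> intvecs K" using that(2,3) by (simp add: intvecs_def)
  qed
  have red: "reduce q (y + scale q z) = reduce q y" for y z
    by (simp add: reduce_eq_iff pointwise)
  show ?thesis
  proof
    assume "reduce q x = reduce q y"
    then obtain z where z: "z \<in> intvecs I" "x = y + scale q z" using div x by blast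
    have "\<sigma> x = \<sigma> y + scale q (\<sigma> z)"
      unfolding z(2) additive_bij_add[OF s x(2) intvecs_closed(5)[OF z(1)]] additive_bij_scale[OF s z(1)] ..
    then show "reduce q (\<sigma> x) = reduce q (\<sigma> y)" using red by simp
  next
    assume "reduce q (\<sigma> x) = reduce q (\<sigma> y)"
    then obtain z' where z': "z' \<in> intvecs I'" "\<sigma> x = \<sigma> y + scale q z'"
      using div additive_bij_mem[OF s] x by blast
    then obtain z where z: "z \<in> intvecs I" "z' = \<sigma> z"
      using additive_bij_surj[OF s] by blast
    have "\<sigma> (y + scale q z) = \<sigma> x"
      unfolding z' z(2) additive_bij_add[OF s x(2) intvecs_closed(5)[OF z(1)]] additive_bij_scale[OF s z(1)] ..
    moreover have "y + scale q z \<in> intvecs I"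
      by (rule intvecs_closed(2)[OF x(2) intvecs_closed(5)[OF z(1)]])
    moreover have "inj_on \<sigma> (intvecs I)" using s by (simp add: additive_bij_def bij_betw_def)
    ultimately have "x = y + scale q z"
      using inj_onD[of \<sigma> "intvecs I" x "y + scale q z"] x(1) by simp
    then show "reduce q x = reduce q y" using red by simp
  qed
qed

lemma has_type_image:
  assumes s: "additive_bij I I' \<sigma>" and H: "has_type p I \<alpha> H"
  shows "has_type p I' \<alpha> (\<sigma> ` H)"
  unfolding has_type_def
proof (intro conjI allI)
  note sH = has_type_submodule[OF H]
  have HI: "x \<in> intvecs I" if "x \<in> H" for x using submodule_of_intvecs[OF sH that] .
  show "submodule_of I' (\<sigma> ` H)"
    unfolding submodule_of_def
  proof (intro conjI ballI subsetI)
    show "y \<in> intvecs I'" if "y \<in> \<sigma> ` H" for y using that additive_bij_mem[OF s] HI by auto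
    show "0 \<in> \<sigma> ` H" using additive_bij_zero[OF s] submodule_of_zero[OF sH] by (metis imageI)
    fix y z assume "y \<in> \<sigma> ` H" "z \<in> \<sigma> ` H"
    then obtain y' z' where yz: "y' \<in> H" "z' \<in> H" "y = \<sigma> y'" "z = \<sigma> z'" by blast
    then have "y - z = \<sigma> (y' - z')" using additive_bij_diff[OF s] HI by simp
    then show "y - z \<in> \<sigma> ` H" using submodule_of_diff[OF sH yz(1,2)] by blast
  qed
  obtain N where N: "\<forall>x\<in>intvecs I. scale (int p ^ N) x \<in> H" using H by (auto simp: has_type_def)
  show "\<exists>N. \<forall>y\<in>intvecs I'. scale (int p ^ N) y \<in> \<sigma> ` H"
  proof (intro exI ballI)
    fix y assume "y \<in> intvecs I'"
    then obtain x where x: "x \<in> intvecs I" "y = \<sigma> x"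
      using additive_bij_surj[OF s] by blast
    then have "scale (int p ^ N) y = \<sigma> (scale (int p ^ N) x)"
      using additive_bij_scale[OF s x(1)] by simp
    then show "scale (int p ^ N) y \<in> \<sigma> ` H" using N x(1) by blast
  qed
  fix j
  have "card (reduce (int p ^ j) ` \<sigma> ` H) = card (reduce (int p ^ j) ` H)"
    unfolding image_image
    by (rule card_image_same_kernel) (use additive_bij_reduce[OF s] HI in blast)
  then show "card (reduce (int p ^ j) ` \<sigma> ` H) = p ^ (\<Sum>a\<leftarrow>\<alpha>. j - a)"
    using has_type_card[OF H] by simp
qed

abbreviation standard_lattice :: "nat \<Rightarrow> nat list \<Rightarrow> (nat \<Rightarrow> int) set" where
  "standard_lattice p \<alpha> \<equiv> diag_lattice {..<length \<alpha>} (\<lambda>i. int p ^ (\<alpha> ! i))"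

lemma has_type_standard_lattice:
  assumes "p > 0"
  shows "has_type p {..<length \<alpha>} \<alpha> (standard_lattice p \<alpha>)"
  unfolding has_type_def
proof (intro conjI allI)
  show "\<exists>N. \<forall>x\<in>intvecs {..<length \<alpha>}. scale (int p ^ N) x \<in> standard_lattice p \<alpha>"
  proof (intro exI ballI)
    fix x assume x: "x \<in> intvecs {..<length \<alpha>}"
    have "int p ^ (\<alpha> ! i) dvd int p ^ sum_list \<alpha>" if "i < length \<alpha>" for i
      using that by (intro le_imp_power_dvd member_le_sum_list) simp_all
    then show "scale (int p ^ sum_list \<alpha>) x \<in> standard_lattice p \<alpha>"
      using x by (auto simp: diag_lattice_def intvecs_def pointwise)
  qed
  show "card (reduce (int p ^ j) ` standard_lattice p \<alpha>) = p ^ (\<Sum>a\<leftarrow>\<alpha>. j - a)" for j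
    using card_reduce_diag_lattice[OF assms, of "{..<length \<alpha>}" j "\<lambda>i. \<alpha> ! i"]
    by (simp add: sum_list_sum_nth atLeast0LessThan)
qed (rule submodule_of_diag_lattice)

text \<open>
This is the existence part of the Smith normal form for the lattices in question: the vector
split off from \<open>H\<close>, divided by \<open>p ^ a\<close>, has \<open>i\<close>-th entry \<open>1\<close>, so together with any basis of the
remaining coordinates it is a basis of the whole group.
\<close>

lemma has_type_adapted_coordinates:
  assumes p: "prime p" and "finite I" "card I = length \<alpha>" "sorted \<alpha>" "has_type p I \<alpha> H"
  shows "\<exists>\<sigma>. additive_bij {..<length \<alpha>} I \<sigma> \<and> H = \<sigma> ` standard_lattice p \<alpha>"
  using assms(2-)
proof (induction \<alpha> arbitrary: I H)
  case Nil
  have 0: "intvecs {} = {0}" by (auto simp: pointwise intvecs_def)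
  have "I = {}" using Nil by simp
  have "H = {0}"
    using submodule_of_intvecs[OF has_type_submodule[OF Nil(4)]]
      submodule_of_zero[OF has_type_submodule[OF Nil(4)]] \<open>I = {}\<close> 0 by auto
  moreover have "standard_lattice p [] = {0}" by (simp add: diag_lattice_def 0)
  ultimately have "H = id ` standard_lattice p []" by simp
  moreover have "additive_bij {..<length []} I id"
    by (simp add: additive_bij_def bij_betw_def \<open>I = {}\<close>)
  ultimately show ?case by blast
next
  case (Cons a \<alpha>)
  note sH = has_type_submodule[OF Cons.prems(4)]
  have dvd: "int p ^ a dvd x k" if "x \<in> H" for x k
    using has_type_dvd[OF Cons.prems(4) _ that] Cons.prems(3) by auto
  then have dvd_H: "\<forall>x\<in>H. \<forall>k. int p ^ a dvd x k" by blast
  obtain x i where x: "x \<in> H" "i \<in> I" "\<not> int p ^ Suc a dvd x i"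
    using has_type_exists_pivot[OF p Cons.prems(4)] by blast
  obtain v where v: "v \<in> H" "v i = int p ^ a" "H = adjoin {y \<in> H. y i = 0} v"
      "has_type p (I - {i}) \<alpha> {y \<in> H. y i = 0}"
    by (rule has_type_split_off[OF p Cons.prems(4) x(2) dvd_H x(1,3)])
  define M where "M = {y \<in> H. y i = 0}"
  define u where "u = (\<lambda>k. v k div int p ^ a)"
  have p0: "int p ^ a \<noteq> 0" using p prime_gt_0_nat by auto
  have vu: "v = scale (int p ^ a) u" using dvd[OF v(1)] by (auto simp: u_def pointwise)
  have ui: "u i = 1" using v(2) p0 by (simp add: u_def)
  have uI: "u \<in> intvecs I" using submodule_of_intvecs[OF sH v(1)] by (simp add: u_def intvecs_def)
  have "finite (I - {i})" "card (I - {i}) = length \<alpha>" "sorted \<alpha>"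
    using Cons.prems x(2) by auto
  from Cons.IH[OF this v(4)] obtain \<tau> where
    "additive_bij {..<length \<alpha>} (I - {i}) \<tau> \<and> {y \<in> H. y i = 0} = \<tau> ` standard_lattice p \<alpha>" ..
  then have \<tau>: "additive_bij {..<length \<alpha>} (I - {i}) \<tau>" and M: "M = \<tau> ` standard_lattice p \<alpha>"
    by (simp_all add: M_def)
  define shift where "shift y = (\<lambda>k. y (Suc k))" for y :: "nat \<Rightarrow> int"
  \<comment> \<open>The coordinate \<open>0\<close> goes to \<open>u\<close>, the others are moved down by one and treated by \<open>\<tau>\<close>.\<close>
  define \<sigma> where "\<sigma> y = scale (y 0) u + \<tau> (shift y)" for y
  let ?n = "length \<alpha>"
  have shift: "shift y \<in> intvecs {..<?n}" if "y \<in> intvecs {..<Suc ?n}" for y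
    using that by (auto simp: shift_def intvecs_def)
  have \<tau>i: "\<tau> y i = 0" and \<tau>I: "\<tau> y \<in> intvecs I" if "y \<in> intvecs {..<?n}" for y
    using additive_bij_mem[OF \<tau> that] by (auto simp: intvecs_def)
  have \<sigma>i: "\<sigma> y i = y 0" if "y \<in> intvecs {..<Suc ?n}" for y
    using \<tau>i[OF shift[OF that]] ui by (simp add: \<sigma>_def pointwise)
  have cons: "case_nat t z \<in> intvecs {..<Suc ?n}" "\<sigma> (case_nat t z) = scale t u + \<tau> z"
    if "z \<in> intvecs {..<?n}" for t z
    using that by (auto simp: intvecs_def \<sigma>_def shift_def split: nat.splits)
  have "additive_bij {..<Suc ?n} I \<sigma>"
    unfolding additive_bij_def bij_betw_def
  proof (intro conjI ballI)
    show "inj_on \<sigma> (intvecs {..<Suc ?n})"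
    proof (rule inj_onI)
      fix y z assume yz: "y \<in> intvecs {..<Suc ?n}" "z \<in> intvecs {..<Suc ?n}" "\<sigma> y = \<sigma> z"
      have 0: "y 0 = z 0" using \<sigma>i[OF yz(1)] \<sigma>i[OF yz(2)] yz(3) by simp
      then have "\<tau> (shift y) = \<tau> (shift z)" using yz(3) by (simp add: \<sigma>_def)
      then have "shift y = shift z"
        using \<tau> shift yz(1,2) by (metis additive_bij_def bij_betw_imp_inj_on inj_onD)
      then have "y k = z k" for k using 0 by (cases k) (auto simp: shift_def fun_eq_iff)
      then show "y = z" by (rule ext)
    qed
    show "\<sigma> ` intvecs {..<Suc ?n} = intvecs I"
    proof (intro equalityI subsetI)
      fix y assume "y \<in> \<sigma> ` intvecs {..<Suc ?n}"
      then obtain z where z: "z \<in> intvecs {..<Suc ?n}" "y = \<sigma> z" by blast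
      show "y \<in> intvecs I"
        unfolding z(2) \<sigma>_def by (intro intvecs_closed uI \<tau>I shift z(1))
    next
      fix y assume y: "y \<in> intvecs I"
      have "y - scale (y i) u \<in> intvecs (I - {i})"
        using y uI ui by (auto simp: intvecs_def pointwise)
      then obtain z where z: "z \<in> intvecs {..<?n}" "\<tau> z = y - scale (y i) u"
        using \<tau> by (metis additive_bij_def bij_betw_imp_surj_on imageE)
      have "\<sigma> (case_nat (y i) z) = y" using cons(2)[OF z(1)] z(2) by simp
      then show "y \<in> \<sigma> ` intvecs {..<Suc ?n}" using cons(1)[OF z(1)] by (metis imageI)
    qed
    fix y z assume yz: "y \<in> intvecs {..<Suc ?n}" "z \<in> intvecs {..<Suc ?n}"
    have "shift (y + z) = shift y + shift z" by (auto simp: shift_def pointwise)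
    then have "\<tau> (shift (y + z)) = \<tau> (shift y) + \<tau> (shift z)"
      using additive_bij_add[OF \<tau> shift[OF yz(1)] shift[OF yz(2)]] by simp
    then show "\<sigma> (y + z) = \<sigma> y + \<sigma> z"
      by (auto simp: \<sigma>_def pointwise algebra_simps)
  qed
  moreover have "H = \<sigma> ` standard_lattice p (a # \<alpha>)"
  proof (intro equalityI subsetI)
    fix h assume "h \<in> H"
    then have "h \<in> adjoin M v" using v(3) by (simp add: M_def)
    then obtain t z where t: "h - scale t v = \<tau> z" "z \<in> standard_lattice p \<alpha>"
      unfolding adjoin_def M by blast
    have zI: "z \<in> intvecs {..<?n}" using t(2) by (simp add: diag_lattice_def)
    have "case_nat (t * int p ^ a) z \<in> standard_lattice p (a # \<alpha>)"
      using t(2) cons(1)[OF zI] by (auto simp: diag_lattice_def nth_Cons split: nat.splits)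
    moreover have "\<sigma> (case_nat (t * int p ^ a) z) = scale t v + \<tau> z"
      unfolding cons(2)[OF zI] vu by (auto simp: pointwise)
    then have "\<sigma> (case_nat (t * int p ^ a) z) = h" using t(1)[symmetric] by simp
    ultimately show "h \<in> \<sigma> ` standard_lattice p (a # \<alpha>)" by (metis imageI)
  next
    fix h assume "h \<in> \<sigma> ` standard_lattice p (a # \<alpha>)"
    then obtain y where y: "y \<in> standard_lattice p (a # \<alpha>)" "h = \<sigma> y" by blast
    have yI: "y \<in> intvecs {..<Suc ?n}" and yd: "int p ^ ((a # \<alpha>) ! k) dvd y k" if "k < Suc ?n" for k
      using y(1) that by (simp_all add: diag_lattice_def)
    have "int p ^ a dvd y 0" using yd[of 0] by simp
    then obtain t where t: "y 0 = int p ^ a * t" by (auto simp: dvd_def)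
    have "shift y \<in> standard_lattice p \<alpha>"
      using shift[OF yI[of 0]] yd[of "Suc _"] by (simp add: diag_lattice_def shift_def)
    then have "\<tau> (shift y) \<in> M" using M by blast
    moreover have "h - scale t v = \<tau> (shift y)"
      unfolding y(2) \<sigma>_def t vu by (auto simp: pointwise)
    ultimately have "h - scale t v \<in> M" by simp
    then have "h \<in> adjoin M v" unfolding adjoin_def by blast
    then show "h \<in> H" using v(3) by (simp add: M_def)
  qed
  ultimately show ?case by auto
qed

section \<open>Lattice bases and matrices\<close>

definition int_comb :: "nat \<Rightarrow> real mat \<Rightarrow> (nat \<Rightarrow> int) \<Rightarrow> real vec" where
  "int_comb n B x = B *\<^sub>v vec n (\<lambda>i. real_of_int (x i))"

text \<open>
Distinct and linearly independent columns amount to a trivial kernel, the form in which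
independence is used from here on.
\<close>

lemma columns_independent_iff:
  fixes B :: "real mat"
  assumes B: "B \<in> carrier_mat m n"
  shows "distinct (cols B) \<and> \<not> module.lin_dep class_ring (module_vec TYPE(real) m) (set (cols B)) \<longleftrightarrow>
    (\<forall>c\<in>carrier_vec n. B *\<^sub>v c = 0\<^sub>v m \<longrightarrow> c = 0\<^sub>v n)"
proof
  interpret vec_space "TYPE(real)" m .
  assume "distinct (cols B) \<and> \<not> lin_dep (set (cols B))"
  then show "\<forall>c\<in>carrier_vec n. B *\<^sub>v c = 0\<^sub>v m \<longrightarrow> c = 0\<^sub>v n"
    using lin_depI[OF B] by blast
next
  interpret vec_space "TYPE(real)" m .
  assume ker: "\<forall>c\<in>carrier_vec n. B *\<^sub>v c = 0\<^sub>v m \<longrightarrow> c = 0\<^sub>v n"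
  have unit: "B *\<^sub>v unit_vec n i = col B i" if "i < n" for i
    using B that by (intro eq_vecI) auto
  have "distinct (cols B)"
    unfolding distinct_conv_nth
  proof (intro allI impI notI)
    fix i j assume ij: "i < length (cols B)" "j < length (cols B)" "i \<noteq> j" "cols B ! i = cols B ! j"
    then have n: "i < n" "j < n" using B by auto
    have "B *\<^sub>v (unit_vec n i - unit_vec n j) = B *\<^sub>v unit_vec n i - B *\<^sub>v unit_vec n j"
      using B by (intro mult_minus_distrib_mat_vec) auto
    also have "\<dots> = col B i - col B j"
      using unit n by simp
    also have "\<dots> = 0\<^sub>v m" using ij B by auto
    finally have "unit_vec n i - unit_vec n j = (0\<^sub>v n :: real vec)" using ker by simp
    then have "(unit_vec n i - unit_vec n j) $ i = (0\<^sub>v n :: real vec) $ i" by simp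
    then show False using n ij(3) by simp
  qed
  moreover from this have "\<not> lin_dep (set (cols B))" using lin_depE[OF B] ker by metis
  ultimately show "distinct (cols B) \<and> \<not> lin_dep (set (cols B))" ..
qed

lemma lattice_basis_iff:
  "lattice_basis m n B L \<longleftrightarrow> B \<in> carrier_mat m n \<and>
    (\<forall>c\<in>carrier_vec n. B *\<^sub>v c = 0\<^sub>v m \<longrightarrow> c = 0\<^sub>v n) \<and> L = int_comb n B ` intvecs {..<n}"
proof -
  have "{B *\<^sub>v map_vec real_of_int c | c. c \<in> carrier_vec n} = int_comb n B ` intvecs {..<n}"
  proof (intro equalityI subsetI)
    fix y assume "y \<in> {B *\<^sub>v map_vec real_of_int c | c. c \<in> carrier_vec n}"
    then obtain c where c: "c \<in> carrier_vec n" "y = B *\<^sub>v map_vec real_of_int c" by blast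
    define x where "x = (\<lambda>i. if i < n then c $ i else 0)"
    have "map_vec real_of_int c = vec n (\<lambda>i. real_of_int (x i))"
      using c(1) by (auto simp: x_def)
    then have "y = int_comb n B x" using c(2) by (simp add: int_comb_def)
    moreover have "x \<in> intvecs {..<n}" by (auto simp: x_def intvecs_def)
    ultimately show "y \<in> int_comb n B ` intvecs {..<n}" by blast
  next
    fix y assume "y \<in> int_comb n B ` intvecs {..<n}"
    then obtain x where x: "y = int_comb n B x" by blast
    have "vec n (\<lambda>i. real_of_int (x i)) = map_vec real_of_int (vec n x)" by auto
    then have "y = B *\<^sub>v map_vec real_of_int (vec n x)" using x by (simp add: int_comb_def)
    then show "y \<in> {B *\<^sub>v map_vec real_of_int c | c. c \<in> carrier_vec n}" by auto
  qed
  then show ?thesis unfolding lattice_basis_def using columns_independent_iff by blast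
qed

lemma int_comb_add:
  assumes "B \<in> carrier_mat m n"
  shows "int_comb n B (x + y) = int_comb n B x + int_comb n B y"
proof -
  have "vec n (\<lambda>i. real_of_int ((x + y) i)) =
      vec n (\<lambda>i. real_of_int (x i)) + vec n (\<lambda>i. real_of_int (y i))"
    by (auto simp: pointwise)
  then show ?thesis
    using assms by (simp add: int_comb_def mult_add_distrib_mat_vec)
qed

lemma inj_on_int_comb:
  assumes "lattice_basis m n B L"
  shows "inj_on (int_comb n B) (intvecs {..<n})"
proof (rule inj_onI)
  fix x y assume xy: "x \<in> intvecs {..<n}" "y \<in> intvecs {..<n}" "int_comb n B x = int_comb n B y"
  have B: "B \<in> carrier_mat m n" using assms by (simp add: lattice_basis_iff)
  let ?r = "\<lambda>x. vec n (\<lambda>i. real_of_int (x i))"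
  have "B *\<^sub>v (?r x - ?r y) = B *\<^sub>v ?r x - B *\<^sub>v ?r y"
    using B by (intro mult_minus_distrib_mat_vec) auto
  also have "\<dots> = 0\<^sub>v m" using xy(3) B by (auto simp: int_comb_def)
  finally have "?r x - ?r y = 0\<^sub>v n" using assms by (auto simp: lattice_basis_iff)
  then have "(?r x - ?r y) $ i = 0\<^sub>v n $ i" for i by simp
  moreover have "(?r x - ?r y) $ i = real_of_int (x i) - real_of_int (y i)" if "i < n" for i
    using that by simp
  ultimately have "x i = y i" if "i < n" for i using that by fastforce
  moreover have "x i = y i" if "\<not> i < n" for i using xy(1,2) that by (simp add: intvecs_def)
  ultimately show "x = y" by blast
qed

lemma change_of_basis:
  assumes B: "lattice_basis m n B L" and B1: "lattice_basis m n B1 L"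
  shows "\<exists>\<tau>. additive_bij {..<n} {..<n} \<tau> \<and> (\<forall>x\<in>intvecs {..<n}. int_comb n B (\<tau> x) = int_comb n B1 x)"
proof (intro exI conjI ballI)
  let ?Z = "intvecs {..<n}"
  define \<tau> where "\<tau> x = inv_into ?Z (int_comb n B) (int_comb n B1 x)" for x
  have im: "int_comb n B ` ?Z = L" "int_comb n B1 ` ?Z = L"
    using B B1 by (auto simp: lattice_basis_iff)
  have C: "B \<in> carrier_mat m n" "B1 \<in> carrier_mat m n" using B B1 by (auto simp: lattice_basis_iff)
  note inj = inj_on_int_comb[OF B] inj_on_int_comb[OF B1]
  show \<tau>: "int_comb n B (\<tau> x) = int_comb n B1 x" if "x \<in> ?Z" for x
    unfolding \<tau>_def by (rule f_inv_into_f[of _ "int_comb n B"]) (use im that in blast)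
  have mem: "\<tau> x \<in> ?Z" if "x \<in> ?Z" for x
    unfolding \<tau>_def by (rule inv_into_into) (use im that in blast)
  show "additive_bij {..<n} {..<n} \<tau>"
    unfolding additive_bij_def bij_betw_def
  proof (intro conjI ballI)
    show "inj_on \<tau> ?Z" using \<tau> inj(2) by (metis inj_onD inj_onI)
    show "\<tau> ` ?Z = ?Z"
    proof (intro equalityI subsetI)
      show "y \<in> ?Z" if "y \<in> \<tau> ` ?Z" for y using that mem by blast
      fix y assume y: "y \<in> ?Z"
      then obtain x where x: "x \<in> ?Z" "int_comb n B1 x = int_comb n B y" using im by (metis imageE imageI)
      then have "\<tau> x = y" using \<tau>[OF x(1)] inj_onD[OF inj(1) _ mem[OF x(1)] y] by simp
      then show "y \<in> \<tau> ` ?Z" using x(1) by blast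
    qed
    fix x y assume xy: "x \<in> ?Z" "y \<in> ?Z"
    have "int_comb n B (\<tau> (x + y)) = int_comb n B (\<tau> x + \<tau> y)"
      using \<tau>[OF intvecs_closed(2)[OF xy]] \<tau>[OF xy(1)] \<tau>[OF xy(2)] int_comb_add C by simp
    then show "\<tau> (x + y) = \<tau> x + \<tau> y"
      by (rule inj_onD[OF inj(1)]) (intro mem intvecs_closed xy)+
  qed
qed

lemma additive_bij_inverse:
  assumes s: "additive_bij I I' \<sigma>"
  shows "additive_bij I' I (inv_into (intvecs I) \<sigma>)"
proof -
  let ?i = "inv_into (intvecs I) \<sigma>"
  have bij: "bij_betw \<sigma> (intvecs I) (intvecs I')" using s by (simp add: additive_bij_def)
  have "?i (y + z) = ?i y + ?i z" if yz: "y \<in> intvecs I'" "z \<in> intvecs I'" for y z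
  proof -
    obtain a b where ab: "a \<in> intvecs I" "y = \<sigma> a" "b \<in> intvecs I" "z = \<sigma> b"
      using additive_bij_surj[OF s] yz by metis
    have "y + z = \<sigma> (a + b)" using additive_bij_add[OF s ab(1,3)] ab by simp
    then show ?thesis
      using ab intvecs_closed(2)[OF ab(1,3)] bij by (simp add: bij_betw_inv_into_left)
  qed
  then show ?thesis using bij_betw_inv_into[OF bij] by (simp add: additive_bij_def)
qed

lemma unit_at_intvecs: "i < n \<Longrightarrow> unit_at i \<in> intvecs {..<n}"
  by (simp add: unit_at_def intvecs_def)

lemma additive_bij_expand:
  assumes s: "additive_bij {..<n} I' \<sigma>"
  shows "k \<le> n \<Longrightarrow> x \<in> intvecs {..<k} \<Longrightarrow> \<sigma> x i = (\<Sum>j<k. \<sigma> (unit_at j) i * x j)"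
proof (induction k arbitrary: x)
  case 0
  then have x: "x = 0" by (auto simp: intvecs_def pointwise)
  show ?case unfolding x additive_bij_zero[OF s] by (simp add: pointwise)
next
  case (Suc k)
  define y where "y = x - scale (x k) (unit_at k)"
  have y: "y \<in> intvecs {..<k}" using Suc.prems by (auto simp: y_def intvecs_def unit_at_def pointwise)
  then have yn: "y \<in> intvecs {..<n}" using Suc.prems by (auto simp: intvecs_def)
  have u: "unit_at k \<in> intvecs {..<n}" using Suc.prems by (intro unit_at_intvecs) simp
  have yj: "y j = x j" if "j < k" for j using that by (simp add: y_def unit_at_def pointwise)
  have "x = y + scale (x k) (unit_at k)" by (simp add: y_def)
  then have "\<sigma> x = \<sigma> (y + scale (x k) (unit_at k))" by simp
  also have "\<dots> = \<sigma> y + scale (x k) (\<sigma> (unit_at k))"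
    unfolding additive_bij_add[OF s yn intvecs_closed(5)[OF u]] additive_bij_scale[OF s u] ..
  finally have "\<sigma> x i = \<sigma> y i + x k * \<sigma> (unit_at k) i" by (simp add: pointwise)
  also have "\<sigma> y i = (\<Sum>j<k. \<sigma> (unit_at j) i * x j)"
    using Suc.IH[OF _ y] Suc.prems yj by simp
  finally show ?case by simp
qed

lemma additive_bij_matrix:
  assumes s: "additive_bij {..<n} I' \<sigma>" and x: "x \<in> intvecs {..<n}"
  shows "mat n n (\<lambda>(i, j). real_of_int (\<sigma> (unit_at j) i)) *\<^sub>v vec n (\<lambda>i. real_of_int (x i)) =
    vec n (\<lambda>i. real_of_int (\<sigma> x i))"
proof (rule eq_vecI)
  fix i assume "i < dim_vec (vec n (\<lambda>i. real_of_int (\<sigma> x i)))"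
  then have i: "i < n" by simp
  show "(mat n n (\<lambda>(i, j). real_of_int (\<sigma> (unit_at j) i)) *\<^sub>v vec n (\<lambda>i. real_of_int (x i))) $ i =
      vec n (\<lambda>i. real_of_int (\<sigma> x i)) $ i"
    using i by (simp add: additive_bij_expand[OF s le_refl x, of i] scalar_prod_def atLeast0LessThan)
qed simp

text \<open>
The new basis is \<open>B\<close> times the matrix of \<open>\<sigma>\<close>.  Its columns are independent over the reals because
the matrix of the inverse of \<open>\<sigma>\<close> is a left inverse.
\<close>

lemma transformed_basis:
  assumes s: "additive_bij {..<n} {..<n} \<sigma>" and B: "lattice_basis m n B L"
  shows "\<exists>B1. lattice_basis m n B1 L \<and> (\<forall>x\<in>intvecs {..<n}. int_comb n B1 x = int_comb n B (\<sigma> x))"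
proof -
  let ?Z = "intvecs {..<n}"
  let ?M = "\<lambda>\<sigma>. mat n n (\<lambda>(i, j). real_of_int (\<sigma> (unit_at j) i))"
  define \<rho> where "\<rho> = inv_into ?Z \<sigma>"
  have r: "additive_bij {..<n} {..<n} \<rho>" unfolding \<rho>_def by (rule additive_bij_inverse[OF s])
  have "bij_betw \<sigma> ?Z ?Z" using s by (simp add: additive_bij_def)
  then have rs: "\<rho> (\<sigma> x) = x" if "x \<in> ?Z" for x
    unfolding \<rho>_def using that by (rule bij_betw_inv_into_left)
  have C: "B \<in> carrier_mat m n" using B by (simp add: lattice_basis_iff)
  have comb: "int_comb n (B * ?M \<sigma>) x = int_comb n B (\<sigma> x)" if "x \<in> ?Z" for x
    using additive_bij_matrix[OF s that] C
    by (simp add: int_comb_def assoc_mult_mat_vec[of _ m n _ n])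
  have MM: "?M \<rho> * ?M \<sigma> = 1\<^sub>m n"
  proof (rule eq_matI)
    fix i j assume "i < dim_row (1\<^sub>m n :: real mat)" "j < dim_col (1\<^sub>m n :: real mat)"
    then have ij: "i < n" "j < n" by auto
    have "(?M \<rho> * ?M \<sigma>) $$ (i, j) = (?M \<rho> *\<^sub>v vec n (\<lambda>k. real_of_int (\<sigma> (unit_at j) k))) $ i"
      using ij by (simp add: scalar_prod_def)
    also have "\<dots> = real_of_int (\<rho> (\<sigma> (unit_at j)) i)"
      using additive_bij_matrix[OF r additive_bij_mem[OF s unit_at_intvecs[OF ij(2)]]] ij by simp
    also have "\<dots> = real_of_int (unit_at j i)" using rs[OF unit_at_intvecs[OF ij(2)]] by simp
    finally show "(?M \<rho> * ?M \<sigma>) $$ (i, j) = 1\<^sub>m n $$ (i, j)"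
      using ij by (simp add: unit_at_def)
  qed auto
  have "c = 0\<^sub>v n" if c: "c \<in> carrier_vec n" "(B * ?M \<sigma>) *\<^sub>v c = 0\<^sub>v m" for c
  proof -
    have "B *\<^sub>v (?M \<sigma> *\<^sub>v c) = 0\<^sub>v m" using c C by (simp add: assoc_mult_mat_vec[of _ m n _ n])
    moreover have "?M \<sigma> *\<^sub>v c \<in> carrier_vec n"
      by (rule mult_mat_vec_carrier[OF _ c(1)]) simp
    ultimately have "?M \<sigma> *\<^sub>v c = 0\<^sub>v n" using B unfolding lattice_basis_iff by blast
    moreover have "?M \<rho> *\<^sub>v 0\<^sub>v n = 0\<^sub>v n" by (rule eq_vecI) simp_all
    ultimately have "?M \<rho> *\<^sub>v (?M \<sigma> *\<^sub>v c) = 0\<^sub>v n" by simp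
    moreover have "?M \<rho> *\<^sub>v (?M \<sigma> *\<^sub>v c) = (?M \<rho> * ?M \<sigma>) *\<^sub>v c"
      using c(1) by (intro assoc_mult_mat_vec[symmetric]) auto
    ultimately show "c = 0\<^sub>v n" using MM c(1) by simp
  qed
  moreover have "L = int_comb n (B * ?M \<sigma>) ` ?Z"
  proof -
    have "int_comb n (B * ?M \<sigma>) ` ?Z = int_comb n B ` \<sigma> ` ?Z"
      unfolding image_image by (rule image_cong[OF refl comb])
    also have "\<sigma> ` ?Z = ?Z" using s by (simp add: additive_bij_def bij_betw_def)
    finally show ?thesis using B by (simp add: lattice_basis_iff)
  qed
  moreover have "B * ?M \<sigma> \<in> carrier_mat m n" using C by auto
  ultimately have "lattice_basis m n (B * ?M \<sigma>) L" unfolding lattice_basis_iff by blast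
  then show ?thesis using comb by blast
qed

definition mat_act :: "nat \<Rightarrow> int mat \<Rightarrow> (nat \<Rightarrow> int) \<Rightarrow> nat \<Rightarrow> int" where
  "mat_act n A x = (\<lambda>i. if i < n then (A *\<^sub>v vec n x) $ i else 0)"

lemma mat_act_intvecs: "mat_act n A x \<in> intvecs {..<n}"
  by (simp add: mat_act_def intvecs_def)

lemma vec_mat_act: "A \<in> carrier_mat n n \<Longrightarrow> vec n (mat_act n A x) = A *\<^sub>v vec n x"
  by (rule eq_vecI) (auto simp: mat_act_def)

lemma mat_act_mult:
  assumes "A \<in> carrier_mat n n" "A' \<in> carrier_mat n n"
  shows "mat_act n (A * A') x = mat_act n A (mat_act n A' x)"
  unfolding mat_act_def[of n A] vec_mat_act[OF assms(2)]
  using assms by (auto simp: mat_act_def assoc_mult_mat_vec[of _ n n _ n])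

lemma mat_act_one: "x \<in> intvecs {..<n} \<Longrightarrow> mat_act n (1\<^sub>m n) x = x"
  by (auto simp: mat_act_def intvecs_def)

lemma mat_act_add:
  assumes "A \<in> carrier_mat n n"
  shows "mat_act n A (x + y) = mat_act n A x + mat_act n A y"
proof -
  have "vec n (x + y) = vec n x + vec n y" by (auto simp: pointwise)
  then have "A *\<^sub>v vec n (x + y) = A *\<^sub>v vec n x + A *\<^sub>v vec n y"
    using assms by (simp add: mult_add_distrib_mat_vec)
  then show ?thesis using assms by (auto simp: mat_act_def pointwise)
qed

lemma additive_bij_mat_act:
  assumes A: "A \<in> carrier_mat n n" and A': "A' \<in> carrier_mat n n"
    and inv: "A * A' = 1\<^sub>m n" "A' * A = 1\<^sub>m n"
  shows "additive_bij {..<n} {..<n} (mat_act n A)"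
  unfolding additive_bij_def
proof (intro conjI ballI)
  show "bij_betw (mat_act n A) (intvecs {..<n}) (intvecs {..<n})"
  proof (rule bij_betwI[where g = "mat_act n A'"])
    show "mat_act n A' (mat_act n A x) = x" if "x \<in> intvecs {..<n}" for x
      using mat_act_one[OF that] mat_act_mult[OF A' A] inv(2) by simp
    show "mat_act n A (mat_act n A' x) = x" if "x \<in> intvecs {..<n}" for x
      using mat_act_one[OF that] mat_act_mult[OF A A'] inv(1) by simp
  qed (auto simp: mat_act_intvecs)
qed (rule mat_act_add[OF A])

lemma mat_act_diagonal:
  assumes D: "D \<in> carrier_mat n n" "diagonal_mat D" and i: "i < n"
  shows "mat_act n D x i = D $$ (i, i) * x i"
proof -
  have "mat_act n D x i = (\<Sum>j\<in>{0..<n}. D $$ (i, j) * x j)"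
    using D i by (simp add: mat_act_def scalar_prod_def)
  also have "\<dots> = (\<Sum>j\<in>{0..<n}. if j = i then D $$ (i, i) * x i else 0)"
    using D i by (intro sum.cong) (auto simp: diagonal_mat_def)
  finally show ?thesis using i by simp
qed

lemma mat_act_diagonal_image:
  assumes D: "D \<in> carrier_mat n n" "diagonal_mat D"
  shows "mat_act n D ` intvecs {..<n} = diag_lattice {..<n} (\<lambda>i. D $$ (i, i))"
proof (intro equalityI subsetI)
  fix y assume "y \<in> mat_act n D ` intvecs {..<n}"
  then show "y \<in> diag_lattice {..<n} (\<lambda>i. D $$ (i, i))"
    using mat_act_diagonal[OF D] mat_act_intvecs by (auto simp: diag_lattice_def)
next
  fix y assume y: "y \<in> diag_lattice {..<n} (\<lambda>i. D $$ (i, i))"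
  define x where "x = (\<lambda>i. if i < n then y i div D $$ (i, i) else 0)"
  have "mat_act n D x i = y i" for i
  proof (cases "i < n")
    case True
    then show ?thesis using y mat_act_diagonal[OF D True] by (simp add: x_def diag_lattice_def)
  next
    case False
    then show ?thesis using y mat_act_intvecs[of n D x] by (simp add: diag_lattice_def intvecs_def)
  qed
  then have "mat_act n D x = y" by blast
  moreover have "x \<in> intvecs {..<n}" by (simp add: x_def intvecs_def)
  ultimately show "y \<in> mat_act n D ` intvecs {..<n}" by blast
qed

lemma int_comb_mult:
  assumes "B \<in> carrier_mat m n" "A \<in> carrier_mat n n"
  shows "int_comb n (B * map_mat real_of_int A) x = int_comb n B (mat_act n A x)"
proof -
  have r: "vec n (\<lambda>i. real_of_int (y i)) = map_vec real_of_int (vec n y)" for y by auto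
  have "map_mat real_of_int A *\<^sub>v map_vec real_of_int (vec n x) = map_vec real_of_int (A *\<^sub>v vec n x)"
    by (rule of_int_hom.mult_mat_vec_hom[OF assms(2), symmetric]) simp
  then show ?thesis
    using assms unfolding int_comb_def r vec_mat_act[OF assms(2)]
    by (simp add: assoc_mult_mat_vec[of _ m n _ n])
qed

section \<open>Counting sublattices\<close>

text \<open>
If \<open>D = P A Q\<close> is the Smith normal form, then the sublattice is \<open>B\<^sub>0 A \<int>\<^sup>n = B\<^sub>0 P' D \<int>\<^sup>n\<close> with \<open>P'\<close> the
inverse of \<open>P\<close>.  So in the coordinates of \<open>B\<close> it is the image of a diagonal lattice under the
automorphism \<open>P'\<close> followed by the change of basis from \<open>B\<^sub>0\<close> to \<open>B\<close>, hence has type \<open>\<alpha>\<close>.  Conversely,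
adapted coordinates for \<open>H\<close> yield a basis of \<open>L\<close> in which the sublattice is given by the diagonal
matrix itself.
\<close>

lemma sublattices_of_type_eq:
  assumes p: "prime p" and n: "length \<alpha> = n" and sorted: "sorted \<alpha>" and B: "lattice_basis m n B L"
  shows "sublattices_of_type m n L \<alpha> p = (`) (int_comb n B) ` {H. has_type p {..<n} \<alpha> H}"
proof (intro equalityI subsetI)
  let ?Z = "intvecs {..<n}"
  fix L' assume "L' \<in> sublattices_of_type m n L \<alpha> p"
  then obtain B0 B' A D where B0: "lattice_basis m n B0 L" and B': "lattice_basis m n B' L'"
    and A: "A \<in> carrier_mat n n" and eq: "B' = B0 * map_mat real_of_int A"
    and snf: "smith_normal_form n A D" and ds: "map (\<lambda>a. int p ^ a) \<alpha> = diag_mat D"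
    unfolding sublattices_of_type_def invariant_factors_def by blast
  obtain P Q where D: "D \<in> carrier_mat n n" "diagonal_mat D"
    and PQ: "P \<in> carrier_mat n n" "Q \<in> carrier_mat n n" "invertible_mat P" "invertible_mat Q" "D = P * A * Q"
    using snf unfolding smith_normal_form_def by blast
  have inverse: "\<exists>R'. R' \<in> carrier_mat n n \<and> R * R' = 1\<^sub>m n \<and> R' * R = 1\<^sub>m n"
    if R: "R \<in> carrier_mat n n" "invertible_mat R" for R :: "int mat"
  proof -
    obtain R' where "inverts_mat R R'" "inverts_mat R' R"
      using R(2) unfolding invertible_mat_def by blast
    then have R': "R * R' = 1\<^sub>m n" "R' * R = 1\<^sub>m (dim_row R')"
      using R(1) by (simp_all add: inverts_mat_def)
    have "dim_col R' = n" using arg_cong[OF R'(1), of dim_col] by simp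
    moreover have "dim_row R' = n" using arg_cong[OF R'(2), of dim_col] R(1) by simp
    ultimately show ?thesis using R' by auto
  qed
  obtain P' where P': "P' \<in> carrier_mat n n" "P * P' = 1\<^sub>m n" "P' * P = 1\<^sub>m n"
    using inverse PQ by blast
  obtain Q' where Q': "Q' \<in> carrier_mat n n" "Q * Q' = 1\<^sub>m n" "Q' * Q = 1\<^sub>m n"
    using inverse PQ by blast
  have "P' * D * Q' = P' * (P * (A * (Q * Q')))"
    using PQ P'(1) Q'(1) A by (simp add: assoc_mult_mat[of _ n n _ n _ n])
  also have "\<dots> = P' * P * (A * (Q * Q'))"
    using PQ P'(1) Q'(1) A by (intro assoc_mult_mat[symmetric, of _ n n _ n _ n]) auto
  also have "\<dots> = A" using P' Q' A by simp
  finally have Aeq: "A = P' * (D * Q')" using P'(1) Q'(1) D by (simp add: assoc_mult_mat[of _ n n _ n _ n])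
  have P'_bij: "additive_bij {..<n} {..<n} (mat_act n P')"
    by (rule additive_bij_mat_act[OF P'(1) PQ(1) P'(3,2)])
  have Q'_bij: "additive_bij {..<n} {..<n} (mat_act n Q')"
    by (rule additive_bij_mat_act[OF Q'(1) PQ(2) Q'(3,2)])
  from change_of_basis[OF B B0] obtain \<tau> where
    "additive_bij {..<n} {..<n} \<tau> \<and> (\<forall>x\<in>?Z. int_comb n B (\<tau> x) = int_comb n B0 x)" ..
  then have \<tau>: "additive_bij {..<n} {..<n} \<tau>" "\<forall>x\<in>?Z. int_comb n B (\<tau> x) = int_comb n B0 x"
    by blast+
  have "D $$ (i, i) = int p ^ (\<alpha> ! i)" if "i < n" for i
    using arg_cong[OF ds, of "\<lambda>l. l ! i"] that n D(1) by (simp add: diag_mat_def)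
  then have std: "diag_lattice {..<n} (\<lambda>i. D $$ (i, i)) = standard_lattice p \<alpha>"
    using n by (auto simp: diag_lattice_def)
  have "L' = int_comb n B0 ` mat_act n A ` ?Z"
    using B' B0 A by (auto simp: lattice_basis_iff eq int_comb_mult image_image)
  also have "mat_act n A ` ?Z = mat_act n P' ` mat_act n D ` mat_act n Q' ` ?Z"
    using P'(1) Q'(1) D by (simp add: Aeq mat_act_mult[OF P'(1)] mat_act_mult[OF D(1)] image_image)
  also have "mat_act n Q' ` ?Z = ?Z" using Q'_bij by (simp add: additive_bij_def bij_betw_def)
  also have "mat_act n D ` ?Z = standard_lattice p \<alpha>" using mat_act_diagonal_image[OF D] std by simp
  also have "int_comb n B0 ` mat_act n P' ` standard_lattice p \<alpha> =
      int_comb n B ` \<tau> ` mat_act n P' ` standard_lattice p \<alpha>"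
    using \<tau>(2) mat_act_intvecs by (auto simp: image_image intro!: image_cong)
  finally have L': "L' = int_comb n B ` \<tau> ` mat_act n P' ` standard_lattice p \<alpha>" .
  have "has_type p {..<n} \<alpha> (\<tau> ` mat_act n P' ` standard_lattice p \<alpha>)"
    using has_type_image[OF \<tau>(1) has_type_image[OF P'_bij]] has_type_standard_lattice[of p \<alpha>] n
      prime_gt_0_nat[OF p] by simp
  then show "L' \<in> (`) (int_comb n B) ` {H. has_type p {..<n} \<alpha> H}" using L' by blast
next
  let ?Z = "intvecs {..<n}"
  fix L' assume "L' \<in> (`) (int_comb n B) ` {H. has_type p {..<n} \<alpha> H}"
  then obtain H where H: "has_type p {..<n} \<alpha> H" and L': "L' = int_comb n B ` H" by blast
  have "finite {..<n}" "card {..<n} = length \<alpha>" using n by simp_all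
  from has_type_adapted_coordinates[OF p this sorted H] obtain \<sigma> where
    "additive_bij {..<length \<alpha>} {..<n} \<sigma> \<and> H = \<sigma> ` standard_lattice p \<alpha>" ..
  then have \<sigma>: "additive_bij {..<n} {..<n} \<sigma>" "H = \<sigma> ` standard_lattice p \<alpha>"
    by (simp_all add: n)
  from transformed_basis[OF \<sigma>(1) B] obtain B1 where
    "lattice_basis m n B1 L \<and> (\<forall>x\<in>?Z. int_comb n B1 x = int_comb n B (\<sigma> x))" ..
  then have B1: "lattice_basis m n B1 L" "\<forall>x\<in>?Z. int_comb n B1 x = int_comb n B (\<sigma> x)"
    by blast+
  define D where "D = mat n n (\<lambda>(i, j). if i = j then int p ^ (\<alpha> ! i) else 0)"
  have D: "D \<in> carrier_mat n n" "diagonal_mat D" "\<And>i. i < n \<Longrightarrow> D $$ (i, i) = int p ^ (\<alpha> ! i)"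
    by (auto simp: D_def diagonal_mat_def)
  have p0: "p > 0" using p prime_gt_0_nat by blast
  have C1: "B1 \<in> carrier_mat m n" using B1(1) by (simp add: lattice_basis_iff)
  let ?B' = "B1 * map_mat real_of_int D"
  have std: "mat_act n D ` ?Z = standard_lattice p \<alpha>"
    using mat_act_diagonal_image[OF D(1,2)] D(3) n by (auto simp: diag_lattice_def)
  have "L' = int_comb n B1 ` standard_lattice p \<alpha>"
    unfolding L' \<sigma>(2) image_image
    by (rule image_cong) (use B1(2) n in \<open>auto simp: diag_lattice_def\<close>)
  then have L'_eq: "L' = int_comb n ?B' ` ?Z"
    by (simp add: int_comb_mult[OF C1 D(1)] image_image flip: std)
  have "c = 0\<^sub>v n" if c: "c \<in> carrier_vec n" "?B' *\<^sub>v c = 0\<^sub>v m" for c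
  proof -
    have "B1 *\<^sub>v (map_mat real_of_int D *\<^sub>v c) = 0\<^sub>v m"
      using c C1 D(1) by (simp add: assoc_mult_mat_vec[of _ m n _ n])
    moreover have "map_mat real_of_int D *\<^sub>v c \<in> carrier_vec n"
      by (rule mult_mat_vec_carrier[OF _ c(1)]) (use D(1) in simp)
    ultimately have z: "map_mat real_of_int D *\<^sub>v c = 0\<^sub>v n"
      using B1(1) unfolding lattice_basis_iff by blast
    have "c $ i = 0" if i: "i < n" for i
    proof -
      have "(map_mat real_of_int D *\<^sub>v c) $ i = (\<Sum>j\<in>{0..<n}. real_of_int (D $$ (i, j)) * c $ j)"
        using c(1) D(1) i by (simp add: scalar_prod_def)
      also have "\<dots> = (\<Sum>j\<in>{0..<n}. if j = i then real_of_int (D $$ (i, i)) * c $ i else 0)"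
        using D(1,2) i by (intro sum.cong) (auto simp: diagonal_mat_def)
      also have "\<dots> = real p ^ (\<alpha> ! i) * c $ i" using i D(3)[OF i] by simp
      finally show ?thesis using z i p0 by simp
    qed
    then show ?thesis using c(1) by (intro eq_vecI) auto
  qed
  then have B': "lattice_basis m n ?B' L'"
    unfolding lattice_basis_iff using L'_eq C1 D(1) by auto
  have inv1: "invertible_mat (1\<^sub>m n :: int mat)"
    by (auto simp: invertible_mat_def inverts_mat_def intro!: exI[of _ "1\<^sub>m n"])
  have "D = 1\<^sub>m n * D * 1\<^sub>m n" using D(1) by simp
  then have PQ: "\<exists>P Q. P \<in> carrier_mat n n \<and> Q \<in> carrier_mat n n \<and>
      invertible_mat P \<and> invertible_mat Q \<and> D = P * D * Q"
    using inv1 one_carrier_mat by blast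
  have chain: "D $$ (i, i) dvd D $$ (Suc i, Suc i)" if "Suc i < n" for i
  proof -
    have "\<alpha> ! i \<le> \<alpha> ! Suc i" using sorted that n by (simp add: sorted_nth_mono)
    then show ?thesis using D(3)[of i] D(3)[of "Suc i"] that by (simp add: le_imp_power_dvd)
  qed
  have snf: "smith_normal_form n D D"
    unfolding smith_normal_form_def using D chain PQ by simp
  have diag: "map (\<lambda>a. int p ^ a) \<alpha> = diag_mat D"
    using D n by (intro nth_equalityI) (auto simp: diag_mat_def)
  have "invariant_factors m n L L' (map (\<lambda>a. int p ^ a) \<alpha>)"
    unfolding invariant_factors_def using B1(1) B' D(1) snf diag by blast
  moreover have "L' \<subseteq> L"
  proof -
    have "H \<subseteq> ?Z" using has_type_submodule[OF H] by (simp add: submodule_of_def)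
    then show ?thesis unfolding L' using B by (auto simp: lattice_basis_iff)
  qed
  ultimately show "L' \<in> sublattices_of_type m n L \<alpha> p"
    using B' unfolding sublattices_of_type_def sublattice_def is_lattice_def by blast
qed

theorem corollary4p1:
  fixes n k :: nat and \<alpha> :: "nat list"
  assumes "1 \<le> n" and "\<alpha> \<in> ordered_partitions n k"
  shows "\<exists>g :: int poly. \<forall>p :: nat. prime p \<longrightarrow>
           (\<forall>m \<Lambda>. is_lattice m n \<Lambda> \<longrightarrow>
              finite (sublattices_of_type m n \<Lambda> \<alpha> p) \<and>
              int (card (sublattices_of_type m n \<Lambda> \<alpha> p)) = poly g (int p))"
proof -
  have \<alpha>: "length \<alpha> = n" "sorted \<alpha>" using assms(2) by (auto simp: ordered_partitions_def)
  obtain g :: "int poly" where g: "\<forall>p I J. prime p \<longrightarrow> finite I \<longrightarrow> J \<subseteq> I \<longrightarrow>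
      card I = length \<alpha> \<longrightarrow> card J = 0 \<longrightarrow> finite (typed_in_frame p I J 0 \<alpha>) \<and>
      int (card (typed_in_frame p I J 0 \<alpha>)) = poly g (int p)"
    using card_typed_in_frame_polynomial[OF \<alpha>(2), of 0 0] by auto
  have "finite (sublattices_of_type m n \<Lambda> \<alpha> p) \<and>
      int (card (sublattices_of_type m n \<Lambda> \<alpha> p)) = poly g (int p)"
    if p: "prime p" and lat: "is_lattice m n \<Lambda>" for p m \<Lambda>
  proof -
    let ?S = "{H. has_type p {..<n} \<alpha> H}"
    obtain B where B: "lattice_basis m n B \<Lambda>" using lat by (auto simp: is_lattice_def)
    have sub: "H \<subseteq> intvecs {..<n}" if "has_type p {..<n} \<alpha> H" for H
      using has_type_submodule[OF that] by (simp add: submodule_of_def)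
    have "typed_in_frame p {..<n} {} 0 \<alpha> = ?S"
      using sub by (auto simp: typed_in_frame_def frame_def diag_lattice_def)
    then have S: "finite ?S" "int (card ?S) = poly g (int p)"
      using g[rule_format, of p "{..<n}" "{}"] p \<alpha>(1) by auto
    have "inj_on ((`) (int_comb n B)) ?S"
      by (rule inj_on_subset[OF inj_on_image_Pow[OF inj_on_int_comb[OF B]]]) (use sub in auto)
    then show ?thesis
      using S by (simp add: sublattices_of_type_eq[OF p \<alpha> B] card_image)
  qed
  then show ?thesis by blast
qed

end
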